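(* Let $(\mathcal X,\mu)$ be a computable probability space. A point $x\in\mathcal X$ is betting random if and only if it is Martin-Löf random.
   Context: A computable Polish space is $(X,d,S)$ with $(X,d)$ complete separable metric and $S=(a_i)$ dense with $d(a_i,a_j)$ uniformly computable. $\Sigma^0_1$ sets: unions of c.e. families of balls $B(a_i,r)$, $r>0$ rational. A computable probability space $(\mathcal X,\mu)$: computable Polish space with Borel probability measure $\mu$, $\mu(U)$ lower semicomputable uniformly in the code of $\Sigma^0_1$ $U$. Martin-Löf test: computable sequence $(U_n)$ of $\Sigma^0_1$ sets with $\mu(U_n)\le2^{-n}$; $x$ is Martin-Löf random if no Martin-Löf test has $x\in\bigcap_nU_n$. An a.e. decidable set is coded by a pair $(U,V)$ of disjoint $\Sigma^0_1$ sets with $\mu(U\cup V)=1$; its complement is coded by $(V,U)$, intersections by $(U\cap U',V\cup V')$, and "$x\in$" the set means $x\in U$. A computable betting strategy consists of a uniformly computable family $\{A_\sigma\}_{\sigma\in2^{<\omega}}$ of (codes of) a.e. decidable sets, the derived family $B_\varepsilon=\mathcal X$, $B_{\sigma1}=B_\sigma\cap A_\sigma$, $B_{\sigma0}=B_\sigma\cap(\mathcal X\setminus A_\sigma)$, and a partial computable $M\colon2^{<\omega}\to[0,\infty)$ with $M(\sigma)$ defined iff $\mu(B_\sigma)>0$ and $M(\sigma0)\mu(B_{\sigma0})+M(\sigma1)\mu(B_{\sigma1})=M(\sigma)\mu(B_\sigma)$ (undefined$\cdot0=0$). It succeeds on $x$ if there is a strictly increasing chain $\sigma_0\prec\sigma_1\prec\cdots$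 in $2^{<\omega}$ with $x\in B_{\sigma_n}$ for all $n$ and $\limsup_nM(\sigma_n)=\infty$. $x$ is betting random if no computable betting strategy succeeds on $x$.
   Formalization: An undefined capital M(σ) (the case μ(B_σ)=0) is given the value ∞ in the limsup, so a strategy also succeeds on points of its null cells along a chain; without this the claim fails, e.g. for a point mass at 0 on [0,1] and x=1. *)

theory Defs
  imports "HOL-Probability.Probability" "HOL-Library.Nat_Bijection" "HOL-Library.Sublist"
begin

section \<open>Partial recursive functions\<close>

text \<open>Several arguments are passed as one number through \<^const>\<open>prod_encode\<close>, so unary programs
  with projections and pairing yield all partial recursive functions.\<close>

datatype prog =
    PZero | PSucc | PFst | PSnd
  | PPair prog prog | PComp prog prog | PPrec prog prog | PMu prog

primrec eval :: "prog \<Rightarrow> nat \<Rightarrow> nat option" where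
  "eval PZero x = Some 0"
| "eval PSucc x = Some (Suc x)"
| "eval PFst x = Some (fst (prod_decode x))"
| "eval PSnd x = Some (snd (prod_decode x))"
| "eval (PPair p q) x =
     Option.bind (eval p x) (\<lambda>u. Option.bind (eval q x) (\<lambda>v. Some (prod_encode (u, v))))"
| "eval (PComp p q) x = Option.bind (eval q x) (eval p)"
| "eval (PPrec p q) x =
     (case prod_decode x of (y, n) \<Rightarrow>
        rec_nat (eval p y)
          (\<lambda>m r. Option.bind r (\<lambda>v. eval q (prod_encode (y, prod_encode (m, v))))) n)"
| "eval (PMu p) x =
     (if \<exists>n. eval p (prod_encode (x, n)) = Some 0
             \<and> (\<forall>m<n. eval p (prod_encode (x, m)) \<noteq> None)
      then Some (LEAST n. eval p (prod_encode (x, n)) = Some 0)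
      else None)"

primrec prog_code :: "prog \<Rightarrow> nat" where
  "prog_code PZero = 0"
| "prog_code PSucc = 1"
| "prog_code PFst = 2"
| "prog_code PSnd = 3"
| "prog_code (PPair p q) = 4 + 4 * prod_encode (prog_code p, prog_code q)"
| "prog_code (PComp p q) = 5 + 4 * prod_encode (prog_code p, prog_code q)"
| "prog_code (PPrec p q) = 6 + 4 * prod_encode (prog_code p, prog_code q)"
| "prog_code (PMu p) = 7 + 4 * prog_code p"

lemma bij_prog_code: "bij prog_code"
proof (rule bijI)
  show "inj prog_code"
  proof (rule injI)
    fix p q show "prog_code p = prog_code q \<Longrightarrow> p = q"
    proof (induction p arbitrary: q)
      case (PPair p1 p2) then show ?case by (cases q; (simp; presburger?))
    next
      case (PComp p1 p2) then show ?case by (cases q; (simp; presburger?))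
    next
      case (PPrec p1 p2) then show ?case by (cases q; (simp; presburger?))
    next
      case (PMu p) then show ?case by (cases q; (simp; presburger?))
    qed (case_tac q; simp)+
  qed
  have "\<exists>p. prog_code p = n" for n
  proof (induction n rule: less_induct)
    case (less n)
    define m where "m = (n - 4) div 4"
    define i where "i = fst (prod_decode m)"
    define j where "j = snd (prod_decode m)"
    have m: "m = prod_encode (i, j)" by (simp add: i_def j_def)
    show ?case
    proof (cases "n < 4")
      case True
      then have "n = 0 \<or> n = 1 \<or> n = 2 \<or> n = 3" by auto
      then show ?thesis by (metis prog_code.simps(1-4))
    next
      case False
      then have "m < n" by (auto simp: m_def)
      moreover have "i \<le> m" "j \<le> m"
        unfolding m by (rule le_prod_encode_1 le_prod_encode_2)+
      ultimately obtain p q r where c: "prog_code p = i" "prog_code q = j" "prog_code r = m"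
        by (meson less le_less_trans)
      have "n = 4 + 4 * m \<or> n = 5 + 4 * m \<or> n = 6 + 4 * m \<or> n = 7 + 4 * m"
        using False unfolding m_def by presburger
      then show ?thesis
        using c m by (metis prog_code.simps(5-8))
    qed
  qed
  then show "surj prog_code" by (metis surjI)
qed

definition partial_recursive :: "(nat \<Rightarrow> nat option) \<Rightarrow> bool" where
  "partial_recursive f \<longleftrightarrow> (\<exists>p. f = eval p)"

definition recursive :: "(nat \<Rightarrow> nat) \<Rightarrow> bool" where
  "recursive f \<longleftrightarrow> partial_recursive (\<lambda>n. Some (f n))"

definition ce :: "nat set \<Rightarrow> bool" where
  "ce S \<longleftrightarrow> (\<exists>f. partial_recursive f \<and> S = {n. f n \<noteq> None})"

definition W :: "nat \<Rightarrow> nat set" where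
  "W e = {n. eval (inv prog_code e) n \<noteq> None}"


section \<open>Computability of real numbers\<close>

text \<open>Only non-negative reals (distances, radii, measures, capitals) occur below, so codes for the
  non-negative rationals suffice.\<close>

definition qrat :: "nat \<Rightarrow> real" where
  "qrat n = (case prod_decode n of (p, q) \<Rightarrow> real p / real (Suc q))"

definition computable_reals :: "(nat \<Rightarrow> real) \<Rightarrow> bool" where
  "computable_reals r \<longleftrightarrow>
     (\<exists>f. recursive f \<and> (\<forall>n k. \<bar>qrat (f (prod_encode (n, k))) - r n\<bar> \<le> (1/2) ^ k))"

definition lower_semicomputable_reals :: "(nat \<Rightarrow> real) \<Rightarrow> bool" where
  "lower_semicomputable_reals r \<longleftrightarrow> ce {prod_encode (n, k) | n k. qrat k < r n}"


section \<open>Computable probability spaces and Martin-Loef randomness\<close>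

text \<open>\<^typ>\<open>'a\<close> carries the complete separable metric, \<^term>\<open>a\<close> enumerates the dense set.\<close>

definition computable_polish_space :: "(nat \<Rightarrow> 'a::polish_space) \<Rightarrow> bool" where
  "computable_polish_space a \<longleftrightarrow>
     closure (range a) = UNIV \<and>
     computable_reals (\<lambda>n. case prod_decode n of (i, j) \<Rightarrow> dist (a i) (a j))"

definition sigma01 :: "(nat \<Rightarrow> 'a::polish_space) \<Rightarrow> nat \<Rightarrow> 'a set" where
  "sigma01 a e = \<Union> {ball (a i) (qrat k) | i k. qrat k > 0 \<and> prod_encode (i, k) \<in> W e}"

definition computable_probability_space ::
    "(nat \<Rightarrow> 'a::polish_space) \<Rightarrow> 'a measure \<Rightarrow> bool" where
  "computable_probability_space a \<mu> \<longleftrightarrow>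
     computable_polish_space a \<and> prob_space \<mu> \<and> sets \<mu> = sets borel \<and>
     lower_semicomputable_reals (\<lambda>e. measure \<mu> (sigma01 a e))"

definition martin_lof_test ::
    "(nat \<Rightarrow> 'a::polish_space) \<Rightarrow> 'a measure \<Rightarrow> (nat \<Rightarrow> 'a set) \<Rightarrow> bool" where
  "martin_lof_test a \<mu> U \<longleftrightarrow>
     (\<exists>f. recursive f \<and> (\<forall>n. U n = sigma01 a (f n))) \<and> (\<forall>n. measure \<mu> (U n) \<le> (1/2) ^ n)"

definition martin_lof_random ::
    "(nat \<Rightarrow> 'a::polish_space) \<Rightarrow> 'a measure \<Rightarrow> 'a \<Rightarrow> bool" where
  "martin_lof_random a \<mu> x \<longleftrightarrow> \<not> (\<exists>U. martin_lof_test a \<mu> U \<and> x \<in> (\<Inter>n. U n))"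


section \<open>Almost everywhere decidable sets\<close>

text \<open>A pair \<^term>\<open>(U, V)\<close> of sets stands for the almost everywhere decidable set \<^term>\<open>U\<close> with
  complement \<^term>\<open>V\<close>.\<close>

definition ae_set :: "(nat \<Rightarrow> 'a::polish_space) \<Rightarrow> nat \<times> nat \<Rightarrow> 'a set \<times> 'a set" where
  "ae_set a c = (sigma01 a (fst c), sigma01 a (snd c))"

definition ae_decidable_code ::
    "(nat \<Rightarrow> 'a::polish_space) \<Rightarrow> 'a measure \<Rightarrow> nat \<times> nat \<Rightarrow> bool" where
  "ae_decidable_code a \<mu> c \<longleftrightarrow>
     (case ae_set a c of (U, V) \<Rightarrow> U \<inter> V = {} \<and> measure \<mu> (U \<union> V) = 1)"

definition ae_compl :: "'a set \<times> 'a set \<Rightarrow> 'a set \<times> 'a set" where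
  "ae_compl P = (snd P, fst P)"

definition ae_inter :: "'a set \<times> 'a set \<Rightarrow> 'a set \<times> 'a set \<Rightarrow> 'a set \<times> 'a set" where
  "ae_inter P Q = (fst P \<inter> fst Q, snd P \<union> snd Q)"

definition ae_mem :: "'a \<Rightarrow> 'a set \<times> 'a set \<Rightarrow> bool" where
  "ae_mem x P \<longleftrightarrow> x \<in> fst P"

definition ae_measure :: "'a measure \<Rightarrow> 'a set \<times> 'a set \<Rightarrow> real" where
  "ae_measure \<mu> P = measure \<mu> (fst P)"


section \<open>Betting strategies\<close>

definition string_code :: "bool list \<Rightarrow> nat" where
  "string_code \<sigma> = list_encode (map of_bool \<sigma>)"

text \<open>Strings grow at the right end, so the recursion runs over the reversed string; the equations
  of the derived family are \<open>cell_Nil\<close>, \<open>cell_snoc_True\<close> and \<open>cell_snoc_False\<close>.\<close>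

primrec cell_rev :: "(bool list \<Rightarrow> 'a set \<times> 'a set) \<Rightarrow> bool list \<Rightarrow> 'a set \<times> 'a set" where
  "cell_rev A [] = (UNIV, {})"
| "cell_rev A (b # \<tau>) =
     ae_inter (cell_rev A \<tau>) (if b then A (rev \<tau>) else ae_compl (A (rev \<tau>)))"

definition cell :: "(bool list \<Rightarrow> 'a set \<times> 'a set) \<Rightarrow> bool list \<Rightarrow> 'a set \<times> 'a set" where
  "cell A \<sigma> = cell_rev A (rev \<sigma>)"

lemma cell_Nil: "cell A [] = (UNIV, {})"
  by (simp add: cell_def)

lemma cell_snoc_True: "cell A (\<sigma> @ [True]) = ae_inter (cell A \<sigma>) (A \<sigma>)"
  by (simp add: cell_def)

lemma cell_snoc_False: "cell A (\<sigma> @ [False]) = ae_inter (cell A \<sigma>) (ae_compl (A \<sigma>))"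
  by (simp add: cell_def)

definition partial_computable_capital :: "(bool list \<Rightarrow> real option) \<Rightarrow> bool" where
  "partial_computable_capital M \<longleftrightarrow>
     (\<exists>f. partial_recursive f \<and>
        (\<forall>\<sigma> k. case M \<sigma> of
            None \<Rightarrow> f (prod_encode (string_code \<sigma>, k)) = None
          | Some y \<Rightarrow> \<exists>v. f (prod_encode (string_code \<sigma>, k)) = Some v
                          \<and> \<bar>qrat v - y\<bar> \<le> (1/2) ^ k))"

text \<open>The product of a capital with a measure, with undefined times 0 equal to 0.\<close>

definition stake :: "real option \<Rightarrow> real \<Rightarrow> real" where
  "stake m p = (case m of None \<Rightarrow> 0 | Some y \<Rightarrow> y * p)"

definition computable_betting_strategy ::
    "(nat \<Rightarrow> 'a::polish_space) \<Rightarrow> 'a measure \<Rightarrow> (bool list \<Rightarrow> nat \<times> nat) \<Rightarrow>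
     (bool list \<Rightarrow> real option) \<Rightarrow> bool" where
  "computable_betting_strategy a \<mu> c M \<longleftrightarrow>
     (let B = cell (\<lambda>\<sigma>. ae_set a (c \<sigma>)) in
      (\<forall>\<sigma>. ae_decidable_code a \<mu> (c \<sigma>)) \<and>
      (\<exists>h. recursive h \<and> (\<forall>\<sigma>. h (string_code \<sigma>) = prod_encode (c \<sigma>))) \<and>
      partial_computable_capital M \<and>
      (\<forall>\<sigma> y. M \<sigma> = Some y \<longrightarrow> y \<ge> 0) \<and>
      (\<forall>\<sigma>. M \<sigma> \<noteq> None \<longleftrightarrow> ae_measure \<mu> (B \<sigma>) > 0) \<and>
      (\<forall>\<sigma>. stake (M (\<sigma> @ [False])) (ae_measure \<mu> (B (\<sigma> @ [False])))
            + stake (M (\<sigma> @ [True])) (ae_measure \<mu> (B (\<sigma> @ [True])))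
          = stake (M \<sigma>) (ae_measure \<mu> (B \<sigma>))))"

text \<open>An undefined capital, i.e. the capital on a null cell, has the value infinity. This is the
  usual convention for martingales over arbitrary measures, and it agrees with undefined times 0
  being 0. It cannot be dropped: if \<open>\<mu>\<close> is the point mass at 0 on the unit interval, then the
  defined capitals of a strategy are all equal, so without the convention the point 1, which lies
  in a null \<open>\<Sigma>\<^sup>0\<^sub>1\<close> set, would be betting random.\<close>

definition capital_value :: "real option \<Rightarrow> ereal" where
  "capital_value m = (case m of None \<Rightarrow> \<infinity> | Some y \<Rightarrow> ereal y)"

definition succeeds_on ::
    "(nat \<Rightarrow> 'a::polish_space) \<Rightarrow> (bool list \<Rightarrow> nat \<times> nat) \<Rightarrow> (bool list \<Rightarrow> real option) \<Rightarrow>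
     'a \<Rightarrow> bool" where
  "succeeds_on a c M x \<longleftrightarrow>
     (\<exists>\<sigma> :: nat \<Rightarrow> bool list.
        (\<forall>n. strict_prefix (\<sigma> n) (\<sigma> (Suc n))) \<and>
        (\<forall>n. ae_mem x (cell (\<lambda>\<tau>. ae_set a (c \<tau>)) (\<sigma> n))) \<and>
        limsup (\<lambda>n. capital_value (M (\<sigma> n))) = \<infinity>)"

definition betting_random ::
    "(nat \<Rightarrow> 'a::polish_space) \<Rightarrow> 'a measure \<Rightarrow> 'a \<Rightarrow> bool" where
  "betting_random a \<mu> x \<longleftrightarrow>
     \<not> (\<exists>c M. computable_betting_strategy a \<mu> c M \<and> succeeds_on a c M x)"

end

theory Submission
  imports Defs
begin

text \<open>Let \<open>x\<close> lie in all the sets \<open>U n\<close> of a Martin-Loef test. Inside a cell of measure at least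
  twice the measure of \<open>U n\<close>, ask for the balls of \<open>U n\<close> one after the other, each time so that the
  capital doubles on a positive answer. As long as all answers are negative, the capital is
  \<open>2 ^ j * (2 - \<mu> base / \<mu> cell)\<close>, which stays nonnegative because the cell has lost at most half of
  its measure. Since \<open>x\<close> lies in \<open>U n\<close>, some answer is positive, and the game goes on inside the new
  cell with a larger \<open>n\<close>. The balls have computable radii with null spheres. If \<open>x\<close> lies on such a
  sphere, the same strategy is applied to a test made of almost everywhere decidable sets that
  contain \<open>x\<close>.

  Conversely, Ville's inequality bounds the measure of the effectively open set of points that have
  a cell of large capital, and these sets form a Martin-Loef test.\<close>

section \<open>Recursive functions and semidecidable predicates\<close>

text \<open>Measures of open sets are only approximable from below, while a capital needs
  approximations from both sides. Hence every query is almost everywhere decidable: a lower bound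
  for its negative part is an upper bound for its positive part. A sphere of given rational radius
  may have positive measure, which forces the perturbed radii.

  The sets of a strategy must be computed on null cells too, where the search for a positive lower
  bound of the measure never ends. That search is therefore spread over the time steps of the game,
  and only the capital is left undefined there.

  The capital is dictated by fairness. Multiplied by the measure of the cell it is
  \<open>2 ^ j * (2 * \<mu> cell - \<mu> base)\<close>. A win replaces base and cell by the part won
  and contributes \<open>2 ^ (j + 1)\<close> times its measure; a loss keeps the base and shrinks
  the cell. Since the two parts share the measure of the cell, the contributions add up to the old
  value.

  \<open>eval\<close> carries no step counter, so the enumerability of the universal function is
  obtained from finite derivations.\<close>

abbreviation pi1 :: "nat \<Rightarrow> nat" where "pi1 x \<equiv> fst (prod_decode x)"
abbreviation pi2 :: "nat \<Rightarrow> nat" where "pi2 x \<equiv> snd (prod_decode x)"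

named_theorems rec_intro

lemma recursiveI: "(\<And>n. eval p n = Some (f n)) \<Longrightarrow> recursive f"
  unfolding recursive_def partial_recursive_def by (metis ext)

lemma recursiveE:
  assumes "recursive f" obtains p where "\<And>n. eval p n = Some (f n)"
  using assms unfolding recursive_def partial_recursive_def by metis

lemma eval_id: "eval (PPair PFst PSnd) x = Some x"
  by simp

lemma recursive_const [rec_intro]: "recursive (\<lambda>_. c)"
proof (induction c)
  case 0 show ?case by (rule recursiveI[of PZero]) simp
next
  case (Suc c)
  then obtain p where "\<And>n. eval p n = Some c" by (rule recursiveE) blast
  then show ?case by (intro recursiveI[of "PComp PSucc p"]) simp
qed

lemma recursive_id [rec_intro]: "recursive (\<lambda>x. x)"
  by (rule recursiveI) (rule eval_id)

lemma recursive_comp: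
  assumes "recursive f" "recursive g" shows "recursive (\<lambda>x. f (g x))"
proof -
  obtain p where "\<And>n. eval p n = Some (f n)" using assms(1) by (rule recursiveE) blast
  moreover obtain q where "\<And>n. eval q n = Some (g n)" using assms(2) by (rule recursiveE) blast
  ultimately show ?thesis by (intro recursiveI[of "PComp p q"]) simp
qed

lemma recursive_Suc [rec_intro]: "recursive f \<Longrightarrow> recursive (\<lambda>x. Suc (f x))"
  by (rule recursive_comp[of Suc]) (rule recursiveI[of PSucc], simp)

lemma recursive_pi1 [rec_intro]: "recursive f \<Longrightarrow> recursive (\<lambda>x. pi1 (f x))"
  by (rule recursive_comp[of pi1]) (rule recursiveI[of PFst], simp)

lemma recursive_pi2 [rec_intro]: "recursive f \<Longrightarrow> recursive (\<lambda>x. pi2 (f x))"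
  by (rule recursive_comp[of pi2]) (rule recursiveI[of PSnd], simp)

lemma recursive_pair [rec_intro]:
  assumes "recursive f" "recursive g" shows "recursive (\<lambda>x. prod_encode (f x, g x))"
proof -
  obtain p where "\<And>n. eval p n = Some (f n)" using assms(1) by (rule recursiveE) blast
  moreover obtain q where "\<And>n. eval q n = Some (g n)" using assms(2) by (rule recursiveE) blast
  ultimately show ?thesis by (intro recursiveI[of "PPair p q"]) simp
qed

lemma recursive_comp2:
  assumes "recursive (\<lambda>z. h (pi1 z) (pi2 z))" "recursive f" "recursive g"
  shows "recursive (\<lambda>x. h (f x) (g x))"
  using recursive_comp[OF assms(1) recursive_pair[OF assms(2,3)]] by simp

text \<open>The nesting of parameter, counter and previous value is the one of \<open>PPrec\<close>.
  The recursion is run with a free counter first; \<open>n x\<close> is substituted for it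
  afterwards.\<close>

lemma recursive_rec_nat [rec_intro]:
  assumes "recursive f" "recursive (\<lambda>z. h (pi1 z) (pi1 (pi2 z)) (pi2 (pi2 z)))" "recursive n"
  shows "recursive (\<lambda>x. rec_nat (f x) (\<lambda>m r. h x m r) (n x))"
proof -
  obtain p where p: "\<And>n. eval p n = Some (f n)" using assms(1) by (rule recursiveE) blast
  obtain q where q: "\<And>z. eval q z = Some (h (pi1 z) (pi1 (pi2 z)) (pi2 (pi2 z)))"
    using assms(2) by (rule recursiveE) blast
  have "eval (PPrec p q) (prod_encode (x, k)) = Some (rec_nat (f x) (\<lambda>m r. h x m r) k)" for x k
    by (induction k) (simp_all add: p q)
  then have "recursive (\<lambda>z. rec_nat (f (pi1 z)) (\<lambda>m r. h (pi1 z) m r) (pi2 z))"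
    by (intro recursiveI[of "PPrec p q"]) (metis prod.collapse prod_decode_inverse)
  from recursive_comp[OF this recursive_pair[OF recursive_id assms(3)]] show ?thesis by simp
qed

lemma recursive_add [rec_intro]:
  assumes "recursive f" "recursive g" shows "recursive (\<lambda>x. f x + g x)"
proof -
  have "recursive (\<lambda>x. rec_nat (f x) (\<lambda>m r. Suc r) (g x))"
    by (intro rec_intro assms)
  moreover have "rec_nat (u::nat) (\<lambda>m r. Suc r) v = u + v" for u v by (induction v) auto
  ultimately show ?thesis by simp
qed

lemma recursive_mult [rec_intro]:
  assumes "recursive f" "recursive g" shows "recursive (\<lambda>x. f x * g x)"
proof -
  have "recursive (\<lambda>x. rec_nat 0 (\<lambda>m r. f x + r) (g x))"
    by (intro rec_intro assms recursive_comp[OF assms(1)])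
  moreover have "rec_nat 0 (\<lambda>m r. u + r) v = u * (v::nat)" for u v by (induction v) auto
  ultimately show ?thesis by simp
qed

lemma recursive_diff [rec_intro]:
  assumes "recursive f" "recursive g" shows "recursive (\<lambda>x. f x - g x)"
proof -
  have "recursive (\<lambda>x. rec_nat 0 (\<lambda>m r. m) x)" by (intro rec_intro)
  moreover have "rec_nat 0 (\<lambda>m r. m) v = v - (1::nat)" for v by (cases v) auto
  ultimately have p: "recursive (\<lambda>x. x - 1)" by simp
  have "recursive (\<lambda>x. rec_nat (f x) (\<lambda>m r. r - 1) (g x))"
    by (intro rec_intro assms recursive_comp[OF p])
  moreover have "rec_nat u (\<lambda>m r. r - 1) v = u - (v::nat)" for u v by (induction v) auto
  ultimately show ?thesis by simp
qed

lemma recursive_power [rec_intro]: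
  assumes "recursive f" "recursive g" shows "recursive (\<lambda>x. f x ^ g x)"
proof -
  have "recursive (\<lambda>x. rec_nat 1 (\<lambda>m r. f x * r) (g x))"
    by (intro rec_intro assms recursive_comp[OF assms(1)])
  moreover have "rec_nat 1 (\<lambda>m r. u * r) v = u ^ v" for u v :: nat by (induction v) auto
  ultimately show ?thesis by simp
qed

section \<open>Decidable predicates\<close>

definition decidable :: "(nat \<Rightarrow> bool) \<Rightarrow> bool" where
  "decidable P \<longleftrightarrow> recursive (\<lambda>x. of_bool (P x))"

lemma recursive_of_bool [rec_intro]: "decidable P \<Longrightarrow> recursive (\<lambda>x. of_bool (P x))"
  by (simp add: decidable_def)

lemma decidable_iff_recursive: "recursive f \<Longrightarrow> (\<And>x. f x = of_bool (P x)) \<Longrightarrow> decidable P"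
  by (metis decidable_def ext)

lemma decidable_comp: "decidable P \<Longrightarrow> recursive f \<Longrightarrow> decidable (\<lambda>x. P (f x))"
  unfolding decidable_def by (rule recursive_comp)

lemma decidable_comp2:
  assumes "decidable (\<lambda>z. P (pi1 z) (pi2 z))" "recursive f" "recursive g"
  shows "decidable (\<lambda>x. P (f x) (g x))"
  using decidable_comp[OF assms(1) recursive_pair[OF assms(2,3)]] by simp

lemma decidable_const [rec_intro]: "decidable (\<lambda>_. P)"
  unfolding decidable_def by (rule recursive_const)

lemma decidable_le [rec_intro]:
  "recursive f \<Longrightarrow> recursive g \<Longrightarrow> decidable (\<lambda>x. f x \<le> g x)"
  by (rule decidable_iff_recursive[of "\<lambda>x. 1 - (f x - g x)"]) (intro rec_intro, auto)

lemma decidable_less [rec_intro]: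
  "recursive f \<Longrightarrow> recursive g \<Longrightarrow> decidable (\<lambda>x. f x < g x)"
  by (rule decidable_iff_recursive[of "\<lambda>x. 1 - (Suc (f x) - g x)"]) (intro rec_intro, auto)

lemma decidable_conj [rec_intro]:
  "decidable P \<Longrightarrow> decidable Q \<Longrightarrow> decidable (\<lambda>x. P x \<and> Q x)"
  by (rule decidable_iff_recursive[of "\<lambda>x. of_bool (P x) * of_bool (Q x)"]) (intro rec_intro, auto)

lemma decidable_not [rec_intro]: "decidable P \<Longrightarrow> decidable (\<lambda>x. \<not> P x)"
  by (rule decidable_iff_recursive[of "\<lambda>x. 1 - of_bool (P x)"]) (intro rec_intro, auto)

lemma decidable_disj [rec_intro]:
  "decidable P \<Longrightarrow> decidable Q \<Longrightarrow> decidable (\<lambda>x. P x \<or> Q x)"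
  using decidable_not[OF decidable_conj[OF decidable_not decidable_not, of P Q]] by simp

lemma decidable_eq [rec_intro]:
  "recursive f \<Longrightarrow> recursive g \<Longrightarrow> decidable (\<lambda>x. f x = g x)"
  using decidable_conj[OF decidable_le[of f g] decidable_le[of g f]] by (simp add: eq_iff)

lemma decidable_ball [rec_intro]:
  assumes P: "decidable (\<lambda>z. P (pi1 z) (pi2 z))" and f: "recursive f"
  shows "decidable (\<lambda>x. \<forall>m<f x. P x m)"
proof -
  have "recursive (\<lambda>x. rec_nat 1 (\<lambda>m r. r * of_bool (P x m)) (f x))"
    by (intro rec_intro f decidable_comp2[OF P])
  moreover have "rec_nat 1 (\<lambda>m r. r * of_bool (P x m)) k = (of_bool (\<forall>m<k. P x m) :: nat)" for x k
    by (induction k) (auto simp: less_Suc_eq)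
  ultimately show ?thesis by (intro decidable_iff_recursive)
qed

lemma decidable_bex [rec_intro]:
  assumes P: "decidable (\<lambda>z. P (pi1 z) (pi2 z))" and f: "recursive f"
  shows "decidable (\<lambda>x. \<exists>m<f x. P x m)"
  using decidable_not[OF decidable_ball[OF decidable_not[OF P] f]] by simp

lemma recursive_if [rec_intro]:
  assumes "decidable P" "recursive f" "recursive g"
  shows "recursive (\<lambda>x. if P x then f x else g x)"
proof -
  have "recursive (\<lambda>x. of_bool (P x) * f x + (1 - of_bool (P x)) * g x)"
    by (intro rec_intro assms)
  moreover have "of_bool p * u + (1 - of_bool p) * v = (if p then u else v)" for p and u v :: nat
    by simp
  ultimately show ?thesis by simp
qed

section \<open>Semidecidable predicates and effective choice\<close>

definition semidecidable :: "(nat \<Rightarrow> bool) \<Rightarrow> bool" where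
  "semidecidable P \<longleftrightarrow>
     (\<exists>D. decidable (\<lambda>z. D (pi1 z) (pi2 z)) \<and> (\<forall>x. P x \<longleftrightarrow> (\<exists>y. D x y)))"

named_theorems sem_intro

lemma semidecidableE:
  assumes "semidecidable P"
  obtains D where "decidable (\<lambda>z. D (pi1 z) (pi2 z))" "\<And>x. P x \<longleftrightarrow> (\<exists>y. D x y)"
  using assms unfolding semidecidable_def by blast

lemma semidecidableI:
  "decidable (\<lambda>z. D (pi1 z) (pi2 z)) \<Longrightarrow> (\<And>x. P x \<longleftrightarrow> (\<exists>y. D x y)) \<Longrightarrow> semidecidable P"
  unfolding semidecidable_def by blast

lemma semidecidable_decidable: 
  assumes "decidable P" shows "semidecidable P"
  by (rule semidecidableI[of "\<lambda>x y. P x"]) (intro decidable_comp[OF assms] rec_intro, simp)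

lemma semidecidable_comp:
  assumes "semidecidable P" "recursive f" shows "semidecidable (\<lambda>x. P (f x))"
proof -
  obtain D where D: "decidable (\<lambda>z. D (pi1 z) (pi2 z))" "\<And>x. P x \<longleftrightarrow> (\<exists>y. D x y)"
    by (rule semidecidableE[OF assms(1)]) (rule that)
  show ?thesis
    by (rule semidecidableI[of "\<lambda>x. D (f x)"])
       (intro decidable_comp2[OF D(1)] recursive_comp[OF assms(2)] rec_intro, simp add: D(2))
qed

lemma semidecidable_comp2:
  assumes "semidecidable (\<lambda>z. P (pi1 z) (pi2 z))" "recursive f" "recursive g"
  shows "semidecidable (\<lambda>x. P (f x) (g x))"
  using semidecidable_comp[OF assms(1) recursive_pair[OF assms(2,3)]] by simp

lemma semidecidable_comp3:
  assumes "semidecidable (\<lambda>z. P (pi1 z) (pi1 (pi2 z)) (pi2 (pi2 z)))"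
    "recursive f" "recursive g" "recursive h"
  shows "semidecidable (\<lambda>x. P (f x) (g x) (h x))"
  using semidecidable_comp[OF assms(1) recursive_pair[OF assms(2) recursive_pair[OF assms(3,4)]]]
  by simp

lemma semidecidable_ex [sem_intro]:
  assumes "semidecidable (\<lambda>z. P (pi1 z) (pi2 z))" shows "semidecidable (\<lambda>x. \<exists>y. P x y)"
proof -
  obtain D where D: "decidable (\<lambda>z. D (pi1 z) (pi2 z))"
      "\<And>z. P (pi1 z) (pi2 z) \<longleftrightarrow> (\<exists>y. D z y)"
    by (rule semidecidableE[OF assms]) (rule that)
  show ?thesis
  proof (rule semidecidableI)
    show "decidable (\<lambda>z. D (prod_encode (pi1 z, pi1 (pi2 z))) (pi2 (pi2 z)))"
      by (intro decidable_comp2[OF D(1)] rec_intro)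
    have "P x y \<longleftrightarrow> (\<exists>w. D (prod_encode (x, y)) w)" for x y
      using D(2)[of "prod_encode (x, y)"] by simp
    then show "(\<exists>y. P x y) \<longleftrightarrow> (\<exists>y. D (prod_encode (x, pi1 y)) (pi2 y))" for x
      by (metis fst_conv prod_encode_inverse snd_conv)
  qed
qed

lemma semidecidable_conj [sem_intro]:
  assumes "semidecidable P" "semidecidable Q" shows "semidecidable (\<lambda>x. P x \<and> Q x)"
proof -
  obtain D where D: "decidable (\<lambda>z. D (pi1 z) (pi2 z))" "\<And>x. P x \<longleftrightarrow> (\<exists>y. D x y)"
    by (rule semidecidableE[OF assms(1)]) (rule that)
  obtain E where E: "decidable (\<lambda>z. E (pi1 z) (pi2 z))" "\<And>x. Q x \<longleftrightarrow> (\<exists>y. E x y)"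
    by (rule semidecidableE[OF assms(2)]) (rule that)
  show ?thesis
  proof (rule semidecidableI)
    show "decidable (\<lambda>z. D (pi1 z) (pi1 (pi2 z)) \<and> E (pi1 z) (pi2 (pi2 z)))"
      by (intro decidable_comp2[OF D(1)] decidable_comp2[OF E(1)] rec_intro)
    show "P x \<and> Q x \<longleftrightarrow> (\<exists>y. D x (pi1 y) \<and> E x (pi2 y))" for x
      unfolding D(2) E(2) by (metis fst_conv prod_encode_inverse snd_conv)
  qed
qed

lemma semidecidable_disj [sem_intro]:
  assumes "semidecidable P" "semidecidable Q" shows "semidecidable (\<lambda>x. P x \<or> Q x)"
proof -
  obtain D where D: "decidable (\<lambda>z. D (pi1 z) (pi2 z))" "\<And>x. P x \<longleftrightarrow> (\<exists>y. D x y)"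
    by (rule semidecidableE[OF assms(1)]) (rule that)
  obtain E where E: "decidable (\<lambda>z. E (pi1 z) (pi2 z))" "\<And>x. Q x \<longleftrightarrow> (\<exists>y. E x y)"
    by (rule semidecidableE[OF assms(2)]) (rule that)
  show ?thesis
    by (rule semidecidableI[of "\<lambda>x y. D x y \<or> E x y"])
       (intro rec_intro D(1) E(1), auto simp: D(2) E(2))
qed

text \<open>Finitely many witnesses have a common bound \<open>Y\<close>; a search for
  \<open>Y\<close> leaves only bounded quantifiers inside.\<close>

lemma semidecidable_all_less [sem_intro]:
  assumes "semidecidable (\<lambda>z. P (pi1 z) (pi2 z))" and f: "recursive f"
  shows "semidecidable (\<lambda>x. \<forall>m<f x. P x m)"
proof -
  obtain D where D: "decidable (\<lambda>z. D (pi1 z) (pi2 z))"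
      "\<And>z. P (pi1 z) (pi2 z) \<longleftrightarrow> (\<exists>y. D z y)"
    by (rule semidecidableE[OF assms(1)]) (rule that)
  have P: "P x y \<longleftrightarrow> (\<exists>w. D (prod_encode (x, y)) w)" for x y
    using D(2)[of "prod_encode (x, y)"] by simp
  show ?thesis
  proof (rule semidecidableI)
    show "decidable (\<lambda>z. \<forall>m<f (pi1 z). \<exists>w<pi2 z. D (prod_encode (pi1 z, m)) w)"
      by (intro decidable_comp2[OF D(1)] recursive_comp[OF f] rec_intro)
    show "(\<forall>m<f x. P x m) \<longleftrightarrow> (\<exists>Y. \<forall>m<f x. \<exists>w<Y. D (prod_encode (x, m)) w)" for x
    proof
      assume "\<forall>m<f x. P x m"
      then obtain w where w: "\<And>m. m < f x \<Longrightarrow> D (prod_encode (x, m)) (w m)"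
        unfolding P by metis
      have "w m < Suc (Max (w ` {..<f x}))" if "m < f x" for m
        using that by (simp add: less_Suc_eq_le)
      with w show "\<exists>Y. \<forall>m<f x. \<exists>w<Y. D (prod_encode (x, m)) w" by blast
    qed (auto simp: P)
  qed
qed

text \<open>Unbounded search over pairs (value, witness).\<close>

lemma semidecidable_selection:
  assumes "semidecidable (\<lambda>z. R (pi1 z) (pi2 z))"
  obtains f where "partial_recursive f" "\<And>x y. f x = Some y \<Longrightarrow> R x y"
    "\<And>x. f x = None \<longleftrightarrow> (\<nexists>y. R x y)"
proof -
  obtain D where D: "decidable (\<lambda>z. D (pi1 z) (pi2 z))"
      "\<And>z. R (pi1 z) (pi2 z) \<longleftrightarrow> (\<exists>w. D z w)"
    by (rule semidecidableE[OF assms]) (rule that)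
  have R: "R x y \<longleftrightarrow> (\<exists>w. D (prod_encode (x, y)) w)" for x y
    using D(2)[of "prod_encode (x, y)"] by simp
  define E where "E x t = D (prod_encode (x, pi1 t)) (pi2 t)" for x t
  have "decidable (\<lambda>z. E (pi1 z) (pi2 z))"
    unfolding E_def by (intro decidable_comp2[OF D(1)] rec_intro)
  \<comment> \<open>\<open>PMu\<close> looks for a zero, hence the negation. The searched function
    is total, so the definedness condition of \<open>PMu\<close> holds automatically.\<close>
  then have "recursive (\<lambda>z. of_bool (\<not> E (pi1 z) (pi2 z)))" by (intro rec_intro)
  then obtain p where p: "\<And>z. eval p z = Some (of_bool (\<not> E (pi1 z) (pi2 z)))"
    by (rule recursiveE) blast
  define f where "f = eval (PComp PFst (PMu p))"
  have f: "f x = (if \<exists>t. E x t then Some (pi1 (LEAST t. E x t)) else None)" for x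
    by (simp add: f_def p)
  have ex: "(\<exists>y. R x y) \<longleftrightarrow> (\<exists>t. E x t)" for x
    unfolding R E_def by (metis fst_conv prod_encode_inverse snd_conv)
  show ?thesis
  proof
    show "partial_recursive f" by (auto simp: partial_recursive_def f_def)
    show "R x y" if "f x = Some y" for x y
    proof -
      have "\<exists>t. E x t" and y: "y = pi1 (LEAST t. E x t)"
        using that by (auto simp: f split: if_splits)
      then have "E x (LEAST t. E x t)" by (metis LeastI)
      then show ?thesis using y by (auto simp: R E_def)
    qed
    show "f x = None \<longleftrightarrow> (\<nexists>y. R x y)" for x
      using ex[of x] by (simp add: f)
  qed
qed

text \<open>The search for a value always ends, so the partial choice function is total. This is how
  later constructions choose intervals and stages effectively.\<close>

lemma recursive_selection:
  assumes "semidecidable (\<lambda>z. R (pi1 z) (pi2 z))" "\<And>x. \<exists>y. R x y"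
  obtains f where "recursive f" "\<And>x. R x (f x)"
proof -
  obtain f where f: "partial_recursive f" "\<And>x y. f x = Some y \<Longrightarrow> R x y"
    "\<And>x. f x = None \<longleftrightarrow> (\<nexists>y. R x y)"
    by (rule semidecidable_selection[OF assms(1)]) (rule that)
  have *: "f x = Some (the (f x))" for x using f(3)[of x] assms(2) by auto
  then have "f = (\<lambda>x. Some (the (f x)))" by auto
  then have "recursive (\<lambda>x. the (f x))" using f(1) unfolding recursive_def by simp
  then show ?thesis using that f(2) * by blast
qed

text \<open>A derivation is a list of triples (program, argument, value), each one justified by later
  entries of the list.\<close>

definition tl_code :: "nat \<Rightarrow> nat" where "tl_code L = pi2 (L - 1)"
definition drop_code :: "nat \<Rightarrow> nat \<Rightarrow> nat" where "drop_code i L = rec_nat L (\<lambda>_. tl_code) i"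
definition hd_code :: "nat \<Rightarrow> nat" where "hd_code L = pi1 (L - 1)"

lemma drop_code: "drop_code i (list_encode xs) = list_encode (drop i xs)"
proof (induction i arbitrary: xs)
  case 0 show ?case by (simp add: drop_code_def)
next
  case (Suc i)
  have "tl_code (list_encode ys) = list_encode (tl ys)" for ys
  proof (cases ys)
    case Nil
    \<comment> \<open>The tail of the empty list must again be coded by 0, so that dropping more
      entries than there are stays at the empty list.\<close>
    have "prod_decode 0 = (0, 0)" by (simp add: prod_decode_def prod_decode_aux.simps)
    then show ?thesis using Nil by (simp add: tl_code_def)
  qed (simp add: tl_code_def)
  then show ?case using Suc by (simp add: drop_code_def tl_drop drop_Suc)
qed

lemma recursive_tl_code [rec_intro]: "recursive f \<Longrightarrow> recursive (\<lambda>x. tl_code (f x))"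
  unfolding tl_code_def by (intro rec_intro)

lemma recursive_hd_code [rec_intro]: "recursive f \<Longrightarrow> recursive (\<lambda>x. hd_code (f x))"
  unfolding hd_code_def by (intro rec_intro)

lemma recursive_drop_code [rec_intro]:
  "recursive f \<Longrightarrow> recursive g \<Longrightarrow> recursive (\<lambda>x. drop_code (f x) (g x))"
  unfolding drop_code_def by (intro rec_intro)

lemma tl_code: "tl_code (list_encode xs) = list_encode (tl xs)"
  using drop_code[of 1 xs] by (simp add: drop_code_def drop_Suc)

lemma hd_code: "hd_code (list_encode (x # xs)) = x"
  by (simp add: hd_code_def)

lemma length_le_list_encode: "length xs \<le> list_encode xs"
proof (induction xs)
  case (Cons x xs)
  then show ?case using le_prod_encode_2[of "list_encode xs" x] by simp
qed simp

lemma list_encode_eq_0: "list_encode xs = 0 \<longleftrightarrow> xs = []"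
  by (cases xs) auto

section \<open>Derivations as finite certificates of evaluation\<close>

definition triple :: "nat \<Rightarrow> nat \<Rightarrow> nat \<Rightarrow> nat" where
  "triple p x v = prod_encode (p, prod_encode (x, v))"

text \<open>One clause for each constructor, two for \<open>PPrec\<close>, following the residues
  modulo 4 in \<open>prog_code\<close>; \<open>r\<close> codes the immediate subprograms.
  \<open>S\<close> is a predicate and not a list, so that it can be list membership in proofs and
  \<open>member_code\<close> in the check on codes.\<close>

definition justifies :: "(nat \<Rightarrow> bool) \<Rightarrow> nat \<Rightarrow> nat \<Rightarrow> nat \<Rightarrow> bool" where
  "justifies S p x v \<longleftrightarrow>
     p = 0 \<and> v = 0 \<or> p = 1 \<and> v = Suc x \<or> p = 2 \<and> v = pi1 x \<or> p = 3 \<and> v = pi2 x \<or>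
     (\<exists>r. p = 4 + 4 * r \<and> S (triple (pi1 r) x (pi1 v)) \<and> S (triple (pi2 r) x (pi2 v))) \<or>
     (\<exists>r u. p = 5 + 4 * r \<and> S (triple (pi2 r) x u) \<and> S (triple (pi1 r) u v)) \<or>
     (\<exists>r. p = 6 + 4 * r \<and> pi2 x = 0 \<and> S (triple (pi1 r) (pi1 x) v)) \<or>
     (\<exists>r m u. p = 6 + 4 * r \<and> pi2 x = Suc m \<and> S (triple p (prod_encode (pi1 x, m)) u) \<and>
        S (triple (pi2 r) (prod_encode (pi1 x, prod_encode (m, u))) v)) \<or>
     (\<exists>r. p = 7 + 4 * r \<and> S (triple r (prod_encode (x, v)) 0) \<and>
        (\<forall>m<v. \<exists>u. S (triple r (prod_encode (x, m)) (Suc u))))"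

definition justified :: "nat \<Rightarrow> (nat \<Rightarrow> bool) \<Rightarrow> bool" where
  "justified t S \<longleftrightarrow> justifies S (pi1 t) (pi1 (pi2 t)) (pi2 (pi2 t))"

lemma justifies_intros:
  "justifies S 0 x 0" "justifies S 1 x (Suc x)" "justifies S 2 x (pi1 x)" "justifies S 3 x (pi2 x)"
  "S (triple p x u) \<Longrightarrow> S (triple q x v) \<Longrightarrow>
     justifies S (4 + 4 * prod_encode (p, q)) x (prod_encode (u, v))"
  "S (triple q x u) \<Longrightarrow> S (triple p u v) \<Longrightarrow> justifies S (5 + 4 * prod_encode (p, q)) x v"
  "pi2 x = 0 \<Longrightarrow> S (triple p (pi1 x) v) \<Longrightarrow> justifies S (6 + 4 * prod_encode (p, q)) x v"
  "pi2 x = Suc m \<Longrightarrow> S (triple (6 + 4 * prod_encode (p, q)) (prod_encode (pi1 x, m)) u) \<Longrightarrow>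
     S (triple q (prod_encode (pi1 x, prod_encode (m, u))) v) \<Longrightarrow>
     justifies S (6 + 4 * prod_encode (p, q)) x v"
  "S (triple p (prod_encode (x, v)) 0) \<Longrightarrow>
     (\<And>m. m < v \<Longrightarrow> S (triple p (prod_encode (x, m)) (Suc (h m)))) \<Longrightarrow> justifies S (7 + 4 * p) x v"
  unfolding justifies_def by (simp_all, (metis fst_conv snd_conv prod_encode_inverse)+)

lemma justified_triple: "justified (triple p x v) S \<longleftrightarrow> justifies S p x v"
  by (simp add: justified_def triple_def)

primrec derivation :: "nat list \<Rightarrow> bool" where
  "derivation [] = True"
| "derivation (t # ts) \<longleftrightarrow> justified t (\<lambda>s. s \<in> set ts) \<and> derivation ts"

lemma triple_inj [simp]: "triple p x v = triple p' x' v' \<longleftrightarrow> p = p' \<and> x = x' \<and> v = v'"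
  by (simp add: triple_def)

text \<open>\<open>S\<close> occurs only positively, so each clause survives an enlargement of
  it.\<close>

lemma justifies_mono:
  assumes "justifies S p x v" "\<And>s. S s \<Longrightarrow> T s" shows "justifies T p x v"
proof -
  have 1: "(\<exists>r. p = 4 + 4 * r \<and> S (triple (pi1 r) x (pi1 v)) \<and> S (triple (pi2 r) x (pi2 v))) \<Longrightarrow>
     (\<exists>r. p = 4 + 4 * r \<and> T (triple (pi1 r) x (pi1 v)) \<and> T (triple (pi2 r) x (pi2 v)))"
    using assms(2) by blast
  have 2: "(\<exists>r u. p = 5 + 4 * r \<and> S (triple (pi2 r) x u) \<and> S (triple (pi1 r) u v)) \<Longrightarrow>
     (\<exists>r u. p = 5 + 4 * r \<and> T (triple (pi2 r) x u) \<and> T (triple (pi1 r) u v))"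
    using assms(2) by blast
  have 3: "(\<exists>r. p = 6 + 4 * r \<and> pi2 x = 0 \<and> S (triple (pi1 r) (pi1 x) v)) \<Longrightarrow>
     (\<exists>r. p = 6 + 4 * r \<and> pi2 x = 0 \<and> T (triple (pi1 r) (pi1 x) v))"
    using assms(2) by blast
  have 4: "(\<exists>r m u. p = 6 + 4 * r \<and> pi2 x = Suc m \<and> S (triple p (prod_encode (pi1 x, m)) u) \<and>
        S (triple (pi2 r) (prod_encode (pi1 x, prod_encode (m, u))) v)) \<Longrightarrow>
     (\<exists>r m u. p = 6 + 4 * r \<and> pi2 x = Suc m \<and> T (triple p (prod_encode (pi1 x, m)) u) \<and>
        T (triple (pi2 r) (prod_encode (pi1 x, prod_encode (m, u))) v))"
    using assms(2) by blast
  have 5: "(\<exists>r. p = 7 + 4 * r \<and> S (triple r (prod_encode (x, v)) 0) \<and>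
        (\<forall>m<v. \<exists>u. S (triple r (prod_encode (x, m)) (Suc u)))) \<Longrightarrow>
     (\<exists>r. p = 7 + 4 * r \<and> T (triple r (prod_encode (x, v)) 0) \<and>
        (\<forall>m<v. \<exists>u. T (triple r (prod_encode (x, m)) (Suc u))))"
    using assms(2) by metis
  show ?thesis using assms(1) unfolding justifies_def using 1 2 3 4 5 by argo
qed

lemma justified_mono: "justified t S \<Longrightarrow> (\<And>s. S s \<Longrightarrow> T s) \<Longrightarrow> justified t T"
  unfolding justified_def by (rule justifies_mono)

lemma derivation_append: "derivation xs \<Longrightarrow> derivation ys \<Longrightarrow> derivation (xs @ ys)"
  by (induction xs) (auto elim: justified_mono)

abbreviation prog_of :: "nat \<Rightarrow> prog" where "prog_of \<equiv> inv prog_code"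

lemma prog_of_code [simp]: "prog_of (prog_code p) = p"
  using bij_prog_code by (simp add: bij_is_inj)

lemma code_prog_of [simp]: "prog_code (prog_of n) = n"
  using bij_prog_code by (simp add: bij_is_surj surj_f_inv_f)

lemma prog_of_simps:
  "prog_of 0 = PZero" "prog_of (Suc 0) = PSucc" "prog_of 2 = PFst" "prog_of 3 = PSnd"
  "prog_of (4 + 4 * r) = PPair (prog_of (pi1 r)) (prog_of (pi2 r))"
  "prog_of (5 + 4 * r) = PComp (prog_of (pi1 r)) (prog_of (pi2 r))"
  "prog_of (6 + 4 * r) = PPrec (prog_of (pi1 r)) (prog_of (pi2 r))"
  "prog_of (7 + 4 * r) = PMu (prog_of r)"
  by (rule inv_f_eq[OF bij_is_inj[OF bij_prog_code]], simp)+

text \<open>\<open>LEAST\<close> speaks about all numbers; this form mentions only arguments up to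
  \<open>v\<close>, which a finite derivation can record.\<close>

lemma eval_PMu_eq_Some:
  "eval (PMu p) x = Some v \<longleftrightarrow> eval p (prod_encode (x, v)) = Some 0 \<and>
     (\<forall>m<v. \<exists>u. eval p (prod_encode (x, m)) = Some (Suc u))" (is "?L \<longleftrightarrow> ?R")
proof
  let ?Z = "\<lambda>n. eval p (prod_encode (x, n)) = Some 0"
  assume ?L
  then obtain n where n: "?Z n" "\<And>m. m < n \<Longrightarrow> eval p (prod_encode (x, m)) \<noteq> None"
    and v: "v = (LEAST n. ?Z n)" by (auto split: if_splits)
  have "?Z v" unfolding v using n(1) by (rule LeastI)
  moreover have "v \<le> n" unfolding v using n(1) by (rule Least_le)
  moreover have "\<exists>u. eval p (prod_encode (x, m)) = Some (Suc u)" if "m < v" for m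
  proof -
    have "\<not> ?Z m" using that unfolding v by (rule not_less_Least)
    moreover have "eval p (prod_encode (x, m)) \<noteq> None" using that \<open>v \<le> n\<close> by (intro n(2)) simp
    ultimately show ?thesis by (metis not0_implies_Suc option.exhaust)
  qed
  ultimately show ?R by blast
next
  assume R: ?R
  have "(LEAST n. eval p (prod_encode (x, n)) = Some 0) = v"
    by (rule Least_equality, use R in simp, rule leI) (use R in fastforce)
  moreover have "\<exists>n. eval p (prod_encode (x, n)) = Some 0 \<and>
      (\<forall>m<n. eval p (prod_encode (x, m)) \<noteq> None)"
    using R by (intro exI[of _ v]) auto
  ultimately show ?L by (simp only: eval.simps if_True)
qed

lemma eval_PPrec_0: "pi2 x = 0 \<Longrightarrow> eval (PPrec p q) x = eval p (pi1 x)"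
  by (simp add: case_prod_beta)

lemma eval_PPrec_Suc:
  "pi2 x = Suc m \<Longrightarrow> eval (PPrec p q) x =
     Option.bind (eval (PPrec p q) (prod_encode (pi1 x, m)))
       (\<lambda>u. eval q (prod_encode (pi1 x, prod_encode (m, u))))"
  by (simp add: case_prod_beta)

lemma justifies_sound:
  assumes "justifies S p x v" and S: "\<And>p x v. S (triple p x v) \<Longrightarrow> eval (prog_of p) x = Some v"
  shows "eval (prog_of p) x = Some v"
proof -
  from assms(1) consider
      "p = 0" "v = 0" | "p = 1" "v = Suc x" | "p = 2" "v = pi1 x" | "p = 3" "v = pi2 x"
    | r where "p = 4 + 4 * r" "S (triple (pi1 r) x (pi1 v))" "S (triple (pi2 r) x (pi2 v))"
    | r u where "p = 5 + 4 * r" "S (triple (pi2 r) x u)" "S (triple (pi1 r) u v)"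
    | r where "p = 6 + 4 * r" "pi2 x = 0" "S (triple (pi1 r) (pi1 x) v)"
    | r m u where "p = 6 + 4 * r" "pi2 x = Suc m" "S (triple p (prod_encode (pi1 x, m)) u)"
        "S (triple (pi2 r) (prod_encode (pi1 x, prod_encode (m, u))) v)"
    | r where "p = 7 + 4 * r" "S (triple r (prod_encode (x, v)) 0)"
        "\<forall>m<v. \<exists>u. S (triple r (prod_encode (x, m)) (Suc u))"
    unfolding justifies_def by (elim disjE exE conjE) blast+
  then show ?thesis
  proof cases
    case 5 with S[OF 5(2)] S[OF 5(3)] show ?thesis by (simp add: prog_of_simps)
  next
    case 6 with S[OF 6(2)] S[OF 6(3)] show ?thesis by (simp add: prog_of_simps)
  next
    case 7 with S[OF 7(3)] show ?thesis by (simp add: prog_of_simps eval_PPrec_0 del: eval.simps)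
  next
    case 8 with S[OF 8(3)] S[OF 8(4)] show ?thesis
      by (simp add: prog_of_simps eval_PPrec_Suc del: eval.simps)
  next
    case 9
    have "\<exists>u. eval (prog_of r) (prod_encode (x, m)) = Some (Suc u)" if "m < v" for m
      using that 9(3) S by blast
    with 9(1) S[OF 9(2)] show ?thesis
      by (simp add: prog_of_simps eval_PMu_eq_Some del: eval.simps)
  qed (simp_all add: prog_of_simps)
qed

lemma derivation_sound:
  "derivation ts \<Longrightarrow> triple p x v \<in> set ts \<Longrightarrow> eval (prog_of p) x = Some v"
proof (induction ts arbitrary: p x v)
  case (Cons t ts)
  show ?case
  proof (cases "triple p x v \<in> set ts")
    case True with Cons show ?thesis by simp
  next
    case False
    with Cons.prems have "justifies (\<lambda>s. s \<in> set ts) p x v" by (auto simp: justified_triple)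
    from justifies_sound[OF this] Cons show ?thesis by auto
  qed
qed simp

definition derivable :: "nat \<Rightarrow> bool" where
  "derivable t \<longleftrightarrow> (\<exists>ts. derivation ts \<and> t \<in> set ts)"

lemma derivable_finite:
  assumes "finite F" "\<And>s. s \<in> F \<Longrightarrow> derivable s"
  obtains ts where "derivation ts" "F \<subseteq> set ts"
proof -
  from assms have "\<exists>ts. derivation ts \<and> F \<subseteq> set ts"
  proof (induction F rule: finite_induct)
    case empty then show ?case by (intro exI[of _ "[]"]) simp
  next
    case (insert s F)
    then obtain ts us where "derivation ts" "F \<subseteq> set ts" "derivation us" "s \<in> set us"
      unfolding derivable_def by (metis insert_iff)
    then show ?case by (intro exI[of _ "us @ ts"]) (auto intro: derivation_append)
  qed
  with that show ?thesis by blast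
qed

text \<open>Derivations of finitely many premises can be concatenated because justification is
  monotone in the available entries; the conclusion is then put in front.\<close>

lemma derivable_justified:
  assumes "justified t (\<lambda>s. s \<in> F)" "finite F" "\<And>s. s \<in> F \<Longrightarrow> derivable s"
  shows "derivable t"
proof -
  obtain ts where "derivation ts" "F \<subseteq> set ts" using derivable_finite[OF assms(2,3)] .
  then have "derivation (t # ts)" using justified_mono[OF assms(1), of "\<lambda>s. s \<in> set ts"] by auto
  then show ?thesis unfolding derivable_def by (metis list.set_intros(1))
qed

lemma eval_derivable: "eval p x = Some v \<Longrightarrow> derivable (triple (prog_code p) x v)"
proof (induction p arbitrary: x v)
  case PZero
  then have v: "v = 0" by simp
  show ?case unfolding v prog_code.simps
    by (rule derivable_justified[of _ "{}"], unfold justified_triple, rule justifies_intros(1)) auto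
next
  case PSucc
  then have v: "v = Suc x" by simp
  show ?case unfolding v prog_code.simps
    by (rule derivable_justified[of _ "{}"], unfold justified_triple, rule justifies_intros(2)) auto
next
  case PFst
  then have v: "v = pi1 x" by simp
  show ?case unfolding v prog_code.simps
    by (rule derivable_justified[of _ "{}"], unfold justified_triple, rule justifies_intros(3)) auto
next
  case PSnd
  then have v: "v = pi2 x" by simp
  show ?case unfolding v prog_code.simps
    by (rule derivable_justified[of _ "{}"], unfold justified_triple, rule justifies_intros(4)) auto
next
  case (PPair p q)
  then obtain u w where u: "eval p x = Some u" "eval q x = Some w" and v: "v = prod_encode (u, w)"
    by (auto simp: bind_eq_Some_conv)
  show ?case unfolding v prog_code.simps
    by (rule derivable_justified[of _ "{triple (prog_code p) x u, triple (prog_code q) x w}"],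
        unfold justified_triple, rule justifies_intros) (use u PPair.IH in auto)
next
  case (PComp p q)
  then obtain u where u: "eval q x = Some u" "eval p u = Some v"
    by (auto simp: bind_eq_Some_conv)
  show ?case unfolding prog_code.simps
    by (rule derivable_justified[of _ "{triple (prog_code q) x u, triple (prog_code p) u v}"],
        unfold justified_triple, rule justifies_intros) (use u PComp.IH in auto)
next
  case (PPrec p q)
  \<comment> \<open>The successor clause refers to the same program at a smaller counter, which the
    structural induction hypothesis does not reach; hence an inner induction on the counter.\<close>
  have "eval (PPrec p q) x = Some v \<Longrightarrow> derivable (triple (prog_code (PPrec p q)) x v)"
  proof (induction "pi2 x" arbitrary: x v)
    case 0
    then have u: "eval p (pi1 x) = Some v" using eval_PPrec_0 by metis
    show ?case unfolding prog_code.simps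
      by (rule derivable_justified[of _ "{triple (prog_code p) (pi1 x) v}"],
          unfold justified_triple, rule justifies_intros(7)[OF 0(1)[symmetric]])
         (use u PPrec.IH in auto)
  next
    case (Suc m)
    then obtain u where u: "eval (PPrec p q) (prod_encode (pi1 x, m)) = Some u"
      "eval q (prod_encode (pi1 x, prod_encode (m, u))) = Some v"
      using eval_PPrec_Suc[of x m p q] by (auto simp: bind_eq_Some_conv simp del: eval.simps(7))
    have d: "derivable (triple (prog_code (PPrec p q)) (prod_encode (pi1 x, m)) u)"
      by (rule Suc.hyps(1)[OF _ u(1)]) simp
    show ?case unfolding prog_code.simps
      by (rule derivable_justified[of _
            "{triple (6 + 4 * prod_encode (prog_code p, prog_code q)) (prod_encode (pi1 x, m)) u,
              triple (prog_code q) (prod_encode (pi1 x, prod_encode (m, u))) v}"],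
          unfold justified_triple, rule justifies_intros(8)[OF Suc.hyps(2)[symmetric]])
         (use d PPrec.IH(2)[OF u(2)] in auto)
  qed
  with PPrec.prems show ?case by blast
next
  case (PMu p)
  then obtain u where u: "eval p (prod_encode (x, v)) = Some 0"
    "\<And>m. m < v \<Longrightarrow> eval p (prod_encode (x, m)) = Some (Suc (u m))"
    unfolding eval_PMu_eq_Some by metis
  let ?F = "insert (triple (prog_code p) (prod_encode (x, v)) 0)
     ((\<lambda>m. triple (prog_code p) (prod_encode (x, m)) (Suc (u m))) ` {..<v})"
  show ?case unfolding prog_code.simps
    by (rule derivable_justified[of _ ?F], unfold justified_triple, rule justifies_intros(9)[of _ _ _ _ u])
       (use u PMu.IH in auto)
qed

text \<open>The counterpart of Kleene's normal form: evaluation becomes the existence of a finite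
  object that can be checked.\<close>

theorem eval_iff_derivable: "eval (prog_of p) x = Some v \<longleftrightarrow> derivable (triple p x v)"
  using eval_derivable[of "prog_of p"] derivation_sound unfolding derivable_def by auto

section \<open>The universal function and the s-m-n theorem\<close>

definition member_code :: "nat \<Rightarrow> nat \<Rightarrow> bool" where
  "member_code t L \<longleftrightarrow> (\<exists>i<L. drop_code i L \<noteq> 0 \<and> hd_code (drop_code i L) = t)"

text \<open>A list is never longer than its code, so the bound \<open>i < L\<close> reaches all
  positions; \<open>drop_code i L \<noteq> 0\<close> discards those past the end.\<close>

lemma member_code: "member_code t (list_encode xs) \<longleftrightarrow> t \<in> set xs"
proof -
  have "drop_code i (list_encode xs) \<noteq> 0 \<and> hd_code (drop_code i (list_encode xs)) = t \<longleftrightarrow>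
      i < length xs \<and> xs ! i = t" for i
    by (auto simp: drop_code list_encode_eq_0 Cons_nth_drop_Suc[symmetric] hd_code
        simp del: list_encode.simps)
  note * = this
  show ?thesis
    unfolding member_code_def in_set_conv_nth * using length_le_list_encode[of xs]
    by (metis less_le_trans)
qed

lemma decidable_member_code [rec_intro]:
  "recursive f \<Longrightarrow> recursive g \<Longrightarrow> decidable (\<lambda>x. member_code (f x) (g x))"
  unfolding member_code_def by (intro rec_intro; erule recursive_comp; intro rec_intro)

lemma recursive_triple [rec_intro]:
  "recursive f \<Longrightarrow> recursive g \<Longrightarrow> recursive h \<Longrightarrow> recursive (\<lambda>x. triple (f x) (g x) (h x))"
  unfolding triple_def by (intro rec_intro)

text \<open>Bounding the positions by the code itself avoids computing the length; positions past
  the end satisfy the first disjunct.\<close>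

lemma derivation_code:
  "derivation xs \<longleftrightarrow> (\<forall>i<list_encode xs. drop_code i (list_encode xs) = 0 \<or>
     justified (hd_code (drop_code i (list_encode xs)))
       (\<lambda>s. member_code s (drop_code (Suc i) (list_encode xs))))"
proof -
  have "derivation xs \<longleftrightarrow> (\<forall>i<length xs. justified (xs ! i) (\<lambda>s. s \<in> set (drop (Suc i) xs)))" for xs
    by (induction xs) (auto simp: less_Suc_eq_0_disj)
  moreover have "i < length xs \<and> justified (xs ! i) (\<lambda>s. s \<in> set (drop (Suc i) xs)) \<longleftrightarrow>
     drop_code i (list_encode xs) \<noteq> 0 \<and> justified (hd_code (drop_code i (list_encode xs)))
       (\<lambda>s. member_code s (drop_code (Suc i) (list_encode xs)))" for i
    by (auto simp: drop_code list_encode_eq_0 Cons_nth_drop_Suc[symmetric] hd_code member_code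
        simp del: list_encode.simps)
  moreover have "i < length xs \<longleftrightarrow> drop_code i (list_encode xs) \<noteq> 0" for i
    by (auto simp: drop_code list_encode_eq_0)
  ultimately show ?thesis using length_le_list_encode[of xs] by (metis less_le_trans)
qed

lemmas sem_dec_intro [sem_intro] =
  semidecidable_decidable[OF decidable_eq] semidecidable_decidable[OF decidable_less]
  semidecidable_decidable[OF decidable_le] semidecidable_decidable[OF decidable_not]
  semidecidable_decidable[OF decidable_const]

text \<open>The universal function is enumerable: a code \<open>L\<close> of a derivation is
  searched. The existential quantifiers inside \<open>justifies\<close> are absorbed by
  semidecidability, and the universal ones are bounded.\<close>

lemma semidecidable_eval:
  "semidecidable (\<lambda>z. eval (prog_of (pi1 z)) (pi1 (pi2 z)) = Some (pi2 (pi2 z)))"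
proof -
  have "derivable t \<longleftrightarrow> (\<exists>L. member_code t L \<and> (\<forall>i<L. drop_code i L = 0 \<or>
      justified (hd_code (drop_code i L)) (\<lambda>s. member_code s (drop_code (Suc i) L))))" for t
    unfolding derivable_def derivation_code by (metis list_decode_inverse member_code)
  then show ?thesis
    unfolding eval_iff_derivable justified_def justifies_def
    by (simp only:) (intro sem_intro semidecidable_decidable[OF decidable_member_code] rec_intro)
qed

lemma semidecidable_graph:
  assumes "partial_recursive f" shows "semidecidable (\<lambda>z. f (pi1 z) = Some (pi2 z))"
proof -
  obtain p where "f = eval p" using assms by (auto simp: partial_recursive_def)
  moreover have "semidecidable (\<lambda>z. eval (prog_of (prog_code p)) (pi1 z) = Some (pi2 z))"
    by (rule semidecidable_comp3[OF semidecidable_eval]) (intro rec_intro)+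
  ultimately show ?thesis by simp
qed

lemma semidecidable_W [sem_intro]:
  assumes "recursive f" "recursive g" shows "semidecidable (\<lambda>x. f x \<in> W (g x))"
proof -
  have "semidecidable (\<lambda>x. \<exists>v. eval (prog_of (g x)) (f x) = Some v)"
    by (intro sem_intro semidecidable_comp3[OF semidecidable_eval] rec_intro
        recursive_comp[OF assms(1)] recursive_comp[OF assms(2)])
  then show ?thesis by (simp add: W_def)
qed

lemma semidecidable_domain:
  assumes "semidecidable P" obtains p where "\<And>x. eval p x \<noteq> None \<longleftrightarrow> P x"
proof -
  have "semidecidable (\<lambda>z. P (pi1 z))" by (intro semidecidable_comp[OF assms] rec_intro)
  then obtain f where "partial_recursive f" "\<And>x. f x = None \<longleftrightarrow> (\<nexists>y::nat. P x)"
    by (rule semidecidable_selection) blast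
  then obtain p where "f = eval p" "\<And>x. f x = None \<longleftrightarrow> \<not> P x"
    by (auto simp: partial_recursive_def)
  then show ?thesis by (metis that)
qed

lemma ce_iff_semidecidable: "ce S \<longleftrightarrow> semidecidable (\<lambda>x. x \<in> S)"
proof
  assume "ce S"
  then obtain p where "S = {n. eval p n \<noteq> None}" by (auto simp: ce_def partial_recursive_def)
  then have "S = W (prog_code p)" by (simp add: W_def)
  then show "semidecidable (\<lambda>x. x \<in> S)" by simp (intro sem_intro rec_intro)
next
  assume "semidecidable (\<lambda>x. x \<in> S)"
  then obtain p where "\<And>x. eval p x \<noteq> None \<longleftrightarrow> x \<in> S" by (rule semidecidable_domain) blast
  then show "ce S" unfolding ce_def partial_recursive_def by blast
qed

text \<open>The parameter \<open>y\<close> is hard-wired by composing the program \<open>p\<close>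
  with a constant program, and the code of the composition is recursive in \<open>y\<close>.\<close>

lemma smn:
  assumes "semidecidable (\<lambda>z. P (pi1 z) (pi2 z))"
  obtains g where "recursive g" "\<And>y x. x \<in> W (g y) \<longleftrightarrow> P y x"
proof -
  obtain p where p: "\<And>z. eval p z \<noteq> None \<longleftrightarrow> P (pi1 z) (pi2 z)"
    using assms by (rule semidecidable_domain) blast
  define const where "const = rec_nat PZero (\<lambda>_. PComp PSucc)"
  have eval_const: "eval (const y) x = Some y" for x y
    by (induction y) (simp_all add: const_def)
  define g where "g y = prog_code (PComp p (PPair (const y) (PPair PFst PSnd)))" for y
  \<comment> \<open>\<open>5 + 4 * prod_encode (1, r)\<close> is the code of
    \<open>PComp PSucc\<close> applied to the program coded by \<open>r\<close>.\<close>
  have code_const: "prog_code (const y) = rec_nat 0 (\<lambda>_ r. 5 + 4 * prod_encode (1, r)) y" for y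
    by (induction y) (simp_all add: const_def)
  have "recursive (\<lambda>y. prog_code (const y))"
    unfolding code_const by (intro rec_intro)
  then have "recursive g" unfolding g_def prog_code.simps by (intro rec_intro)
  moreover have "x \<in> W (g y) \<longleftrightarrow> P y x" for y x
    unfolding W_def g_def mem_Collect_eq prog_of_code
    using p[of "prod_encode (y, x)"] by (simp add: eval_const)
  ultimately show ?thesis by (rule that)
qed

text \<open>A pair of accumulator and remaining list is iterated. The code of the list serves as the
  number of iterations: it is at least the length, and \<open>step\<close> is the identity once the
  list is empty.\<close>

lemma recursive_foldl:
  assumes F: "recursive (\<lambda>z. F (pi1 z) (pi2 z))" and "recursive s" "recursive g"
  shows "recursive (\<lambda>x. foldl F (s x) (list_decode (g x)))"
proof -
  define step where "step z =
    (if pi2 z = 0 then z else prod_encode (F (pi1 z) (hd_code (pi2 z)), tl_code (pi2 z)))" for z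
  have step: "recursive step" unfolding step_def by (intro rec_intro recursive_comp2[OF F])
  have "recursive (\<lambda>x. pi1 (rec_nat (prod_encode (s x, g x)) (\<lambda>m r. step r) (g x)))"
    by (intro rec_intro assms(2,3) recursive_comp[OF step])
  moreover have "rec_nat (prod_encode (u, list_encode xs)) (\<lambda>m r. step r) k =
      prod_encode (foldl F u (take k xs), list_encode (drop k xs))" for u xs k
  proof (induction k)
    case (Suc k)
    show ?case
    proof (cases "k < length xs")
      case True
      then have *: "drop k xs = xs ! k # drop (Suc k) xs" by (simp add: Cons_nth_drop_Suc)
      show ?thesis using Suc True
        by (simp add: step_def list_encode_eq_0 * hd_code tl_code take_Suc_conv_app_nth
            del: list_encode.simps)
    next
      case False with Suc show ?thesis by (simp add: step_def)
    qed
  qed simp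
  from this[of _ "list_decode (g _)" "g _"]
  have "pi1 (rec_nat (prod_encode (s x, g x)) (\<lambda>m r. step r) (g x)) =
      foldl F (s x) (list_decode (g x))" for x
    using length_le_list_encode[of "list_decode (g x)"] by simp
  ultimately show ?thesis by simp
qed

section \<open>Computable rational functions\<close>

text \<open>Differences such as \<open>1 - (1 / 2) ^ n\<close> minus a further term may be negative,
  while \<open>qrat\<close> covers only nonnegative rationals; hence the numerator is a difference
  of two naturals.\<close>

definition rational_recursive :: "(nat \<Rightarrow> real) \<Rightarrow> bool" where
  "rational_recursive F \<longleftrightarrow> (\<exists>f g h. recursive f \<and> recursive g \<and> recursive h \<and>
     (\<forall>x. F x = (real (f x) - real (g x)) / real (Suc (h x))))"

lemma rational_recursiveI:
  "recursive f \<Longrightarrow> recursive g \<Longrightarrow> recursive h \<Longrightarrow>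
   (\<And>x. F x = (real (f x) - real (g x)) / real (Suc (h x))) \<Longrightarrow> rational_recursive F"
  unfolding rational_recursive_def by blast

lemma rational_recursiveE:
  assumes "rational_recursive F"
  obtains f g h where "recursive f" "recursive g" "recursive h"
    "F = (\<lambda>x. (real (f x) - real (g x)) / real (Suc (h x)))"
  using assms unfolding rational_recursive_def by (metis ext)

lemma rational_recursive_of_nat [rec_intro]:
  "recursive f \<Longrightarrow> rational_recursive (\<lambda>x. real (f x))"
  by (rule rational_recursiveI[of f "\<lambda>_. 0" "\<lambda>_. 0"]) (intro rec_intro | simp)+

lemma rational_recursive_numeral [rec_intro]:
  "rational_recursive (\<lambda>_. numeral k)" "rational_recursive (\<lambda>_. 1)" "rational_recursive (\<lambda>_. 0)"
  using rational_recursive_of_nat[OF recursive_const[of "numeral k"]]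
    rational_recursive_of_nat[OF recursive_const[of 1]]
    rational_recursive_of_nat[OF recursive_const[of 0]] by simp_all

lemma rational_recursive_comp:
  assumes "rational_recursive F" "recursive k" shows "rational_recursive (\<lambda>x. F (k x))"
proof -
  obtain f g h where *: "recursive f" "recursive g" "recursive h"
    "F = (\<lambda>x. (real (f x) - real (g x)) / real (Suc (h x)))"
    using assms(1) by (rule rational_recursiveE)
  show ?thesis
    by (rule rational_recursiveI[of "\<lambda>x. f (k x)" "\<lambda>x. g (k x)" "\<lambda>x. h (k x)"])
       (intro recursive_comp[OF _ assms(2)] * | simp add: *(4))+
qed

text \<open>Denominators are stored as predecessors, so a product of denominators is stored as the
  product minus one.\<close>

lemma of_nat_Suc_mult_diff: "real (Suc (Suc c * Suc d - 1)) = real (Suc c) * real (Suc d)"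
  by (simp del: of_nat_Suc of_nat_mult add: of_nat_mult[symmetric])

lemma diff_frac:
  "(a - b) / real (Suc c) - (a' - b') / real (Suc d) =
   (a * real (Suc d) + b' * real (Suc c) - (b * real (Suc d) + a' * real (Suc c))) /
   (real (Suc c) * real (Suc d))"
  by (subst diff_frac_eq) (simp_all add: algebra_simps del: of_nat_Suc)

lemma mult_frac:
  "(a - b) / real (Suc c) * ((a' - b') / real (Suc d)) =
   (a * a' + b * b' - (a * b' + b * a')) / (real (Suc c) * real (Suc d))"
  by (simp add: algebra_simps del: of_nat_Suc)

lemma rational_recursive_diff [rec_intro]:
  assumes "rational_recursive F" "rational_recursive G"
  shows "rational_recursive (\<lambda>x. F x - G x)"
proof -
  obtain f g h where 1: "recursive f" "recursive g" "recursive h"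
    "F = (\<lambda>x. (real (f x) - real (g x)) / real (Suc (h x)))"
    using assms(1) by (rule rational_recursiveE)
  obtain f' g' h' where 2: "recursive f'" "recursive g'" "recursive h'"
    "G = (\<lambda>x. (real (f' x) - real (g' x)) / real (Suc (h' x)))"
    using assms(2) by (rule rational_recursiveE)
  show ?thesis
    by (rule rational_recursiveI[of "\<lambda>x. f x * Suc (h' x) + g' x * Suc (h x)"
          "\<lambda>x. g x * Suc (h' x) + f' x * Suc (h x)" "\<lambda>x. Suc (h x) * Suc (h' x) - 1"])
       (intro rec_intro 1 2 | simp only: 1(4) 2(4) diff_frac of_nat_Suc_mult_diff of_nat_add of_nat_mult)+
qed

lemma rational_recursive_mult [rec_intro]:
  assumes "rational_recursive F" "rational_recursive G"
  shows "rational_recursive (\<lambda>x. F x * G x)"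
proof -
  obtain f g h where 1: "recursive f" "recursive g" "recursive h"
    "F = (\<lambda>x. (real (f x) - real (g x)) / real (Suc (h x)))"
    using assms(1) by (rule rational_recursiveE)
  obtain f' g' h' where 2: "recursive f'" "recursive g'" "recursive h'"
    "G = (\<lambda>x. (real (f' x) - real (g' x)) / real (Suc (h' x)))"
    using assms(2) by (rule rational_recursiveE)
  show ?thesis
    by (rule rational_recursiveI[of "\<lambda>x. f x * f' x + g x * g' x"
          "\<lambda>x. f x * g' x + g x * f' x" "\<lambda>x. Suc (h x) * Suc (h' x) - 1"])
       (intro rec_intro 1 2 | simp only: 1(4) 2(4) mult_frac of_nat_Suc_mult_diff of_nat_add of_nat_mult)+
qed

lemma rational_recursive_add [rec_intro]:
  assumes "rational_recursive F" "rational_recursive G"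
  shows "rational_recursive (\<lambda>x. F x + G x)"
proof -
  have "rational_recursive (\<lambda>x. F x - (0 - G x))" by (intro rec_intro assms)
  then show ?thesis by simp
qed

lemma rational_recursive_divide [rec_intro]:
  assumes "rational_recursive F" "rational_recursive G"
  shows "rational_recursive (\<lambda>x. F x / G x)"
proof -
  obtain f g h where 1: "recursive f" "recursive g" "recursive h"
    "G = (\<lambda>x. (real (f x) - real (g x)) / real (Suc (h x)))"
    using assms(2) by (rule rational_recursiveE)
  have "rational_recursive (\<lambda>x. 1 / G x)"
  proof (rule rational_recursiveI)
    \<comment> \<open>At most one of the truncated differences is positive, so the denominator is
      the absolute difference of \<open>f x\<close> and \<open>g x\<close>, or 1 if they agree. In
      that case both numerators are 0, in accordance with \<open>1 / 0 = 0\<close>.\<close>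
    show "1 / G x = (real (if g x < f x then Suc (h x) else 0)
        - real (if f x < g x then Suc (h x) else 0)) /
        real (Suc ((f x - g x - 1) + (g x - f x - 1)))" for x
      by (simp add: 1(4) of_nat_diff divide_simps) (simp add: algebra_simps)
  qed (intro rec_intro 1)+
  from rational_recursive_mult[OF assms(1) this] show ?thesis by simp
qed

lemma rational_recursive_power [rec_intro]:
  assumes "recursive f" shows "rational_recursive (\<lambda>x. numeral k ^ f x)"
  using rational_recursive_of_nat[OF recursive_power[OF recursive_const assms], of "numeral k"]
  by simp

lemma rational_recursive_half_power [rec_intro]:
  assumes "recursive f" shows "rational_recursive (\<lambda>x. (1 / 2) ^ f x)"
  unfolding power_one_over by (intro rec_intro assms)

lemma rational_recursive_qrat [rec_intro]:
  assumes "recursive f" shows "rational_recursive (\<lambda>x. qrat (f x))"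
  unfolding qrat_def case_prod_beta by (intro rec_intro assms)

lemma decidable_rational_less [rec_intro]:
  assumes "rational_recursive F" "rational_recursive G"
  shows "decidable (\<lambda>x. F x < G x)"
proof -
  have "rational_recursive (\<lambda>x. G x - F x)" by (intro rec_intro assms)
  then obtain f g h where 1: "recursive f" "recursive g" "recursive h"
    "(\<lambda>x. G x - F x) = (\<lambda>x. (real (f x) - real (g x)) / real (Suc (h x)))"
    by (rule rational_recursiveE)
  have "F x < G x \<longleftrightarrow> g x < f x" for x
  proof -
    have "F x < G x \<longleftrightarrow> 0 < G x - F x" by simp
    also have "\<dots> \<longleftrightarrow> g x < f x" unfolding fun_cong[OF 1(4)] by (simp add: zero_less_divide_iff)
    finally show ?thesis .
  qed
  then show ?thesis by simp (intro rec_intro 1)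
qed

lemma decidable_rational_le [rec_intro]:
  assumes "rational_recursive F" "rational_recursive G"
  shows "decidable (\<lambda>x. F x \<le> G x)"
  unfolding not_less[symmetric] by (intro rec_intro assms)

lemmas semidecidable_rational [sem_intro] =
  semidecidable_decidable[OF decidable_rational_less]
  semidecidable_decidable[OF decidable_rational_le]

lemma qrat_nonneg: "qrat n \<ge> 0"
  by (simp add: qrat_def case_prod_beta)

lemma qrat_dense:
  assumes "0 \<le> x" "x < y" obtains k where "x < qrat k" "qrat k < y"
proof -
  obtain r where r: "r \<in> \<rat>" "x < r" "r < y" using Rats_dense_in_real[OF assms(2)] by blast
  then obtain m n :: nat where mn: "n \<noteq> 0" "\<bar>r\<bar> = real m / real n"
    by (metis Rats_abs_nat_div_natE)
  have "qrat (prod_encode (m, n - 1)) = r" using mn r assms by (simp add: qrat_def)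
  with r that show ?thesis by metis
qed

section \<open>Effectively open sets\<close>

locale computable_space =
  fixes a :: "nat \<Rightarrow> 'a::polish_space" and \<mu> :: "'a measure"
  assumes computable: "computable_probability_space a \<mu>"
begin

sublocale prob_space \<mu>
  using computable by (simp add: computable_probability_space_def)

lemma sets_mu: "sets \<mu> = sets borel"
  using computable by (simp add: computable_probability_space_def)

lemma space_mu [simp]: "space \<mu> = UNIV"
  using sets_eq_imp_space_eq[OF sets_mu] by simp

lemma open_sets [measurable]: "open U \<Longrightarrow> U \<in> sets \<mu>"
  by (simp add: sets_mu)

lemma computable_dist:
  obtains d where "recursive d"
    "\<And>i j k. \<bar>qrat (d (prod_encode (prod_encode (i, j), k))) - dist (a i) (a j)\<bar> \<le> (1 / 2) ^ k"
proof -
  obtain d where "recursive d"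
    "\<forall>n k. \<bar>qrat (d (prod_encode (n, k))) - (case prod_decode n of (i, j) \<Rightarrow> dist (a i) (a j))\<bar>
       \<le> (1 / 2) ^ k"
    using computable
    by (auto simp: computable_probability_space_def computable_polish_space_def computable_reals_def)
  from this(1) this(2)[rule_format, of "prod_encode (_, _)"] show ?thesis
    by (intro that[of d]) auto
qed

lemma half_power_less: "0 < (e::real) \<Longrightarrow> \<exists>k. (1 / 2) ^ k < e"
  using real_arch_pow_inv[of e "1 / 2"] by auto

text \<open>A strict inequality shows at finite precision: once the error is below half of the gap,
  the approximation plus its error is still below the bound.\<close>

lemma semidecidable_dist_less [sem_intro]:
  assumes "recursive f" "recursive g" "rational_recursive F"
  shows "semidecidable (\<lambda>x. dist (a (f x)) (a (g x)) < F x)"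
proof -
  obtain d where d: "recursive d"
    "\<And>i j k. \<bar>qrat (d (prod_encode (prod_encode (i, j), k))) - dist (a i) (a j)\<bar> \<le> (1 / 2) ^ k"
    by (rule computable_dist) (rule that)
  have "dist (a i) (a j) < r \<longleftrightarrow>
      (\<exists>k. qrat (d (prod_encode (prod_encode (i, j), k))) + (1 / 2) ^ k < r)" for i j r
  proof
    assume "dist (a i) (a j) < r"
    then obtain k where "(1 / 2) ^ k < (r - dist (a i) (a j)) / 2"
      using half_power_less[of "(r - dist (a i) (a j)) / 2"] by auto
    moreover have "\<bar>q - t\<bar> \<le> e \<Longrightarrow> e < (r - t) / 2 \<Longrightarrow> q + e < r" for q t e by argo
    ultimately show "\<exists>k. qrat (d (prod_encode (prod_encode (i, j), k))) + (1 / 2) ^ k < r"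
      using d(2)[of i j k] by blast
  next
    assume "\<exists>k. qrat (d (prod_encode (prod_encode (i, j), k))) + (1 / 2) ^ k < r"
    then obtain k where "qrat (d (prod_encode (prod_encode (i, j), k))) + (1 / 2) ^ k < r" ..
    with d(2)[of i j k] show "dist (a i) (a j) < r" by linarith
  qed
  then show ?thesis
    by (simp only:) (intro sem_intro rec_intro recursive_comp[OF d(1)] recursive_comp[OF assms(1)]
        recursive_comp[OF assms(2)] rational_recursive_comp[OF assms(3)])
qed

lemma semidecidable_dist_greater [sem_intro]:
  assumes "recursive f" "recursive g" "rational_recursive F"
  shows "semidecidable (\<lambda>x. F x < dist (a (f x)) (a (g x)))"
proof -
  obtain d where d: "recursive d"
    "\<And>i j k. \<bar>qrat (d (prod_encode (prod_encode (i, j), k))) - dist (a i) (a j)\<bar> \<le> (1 / 2) ^ k"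
    by (rule computable_dist) (rule that)
  have "r < dist (a i) (a j) \<longleftrightarrow>
      (\<exists>k. r < qrat (d (prod_encode (prod_encode (i, j), k))) - (1 / 2) ^ k)" for i j r
  proof
    assume "r < dist (a i) (a j)"
    then obtain k where "(1 / 2) ^ k < (dist (a i) (a j) - r) / 2"
      using half_power_less[of "(dist (a i) (a j) - r) / 2"] by auto
    moreover have "\<bar>q - t\<bar> \<le> e \<Longrightarrow> e < (t - r) / 2 \<Longrightarrow> r < q - e" for q t e by argo
    ultimately show "\<exists>k. r < qrat (d (prod_encode (prod_encode (i, j), k))) - (1 / 2) ^ k"
      using d(2)[of i j k] by blast
  next
    assume "\<exists>k. r < qrat (d (prod_encode (prod_encode (i, j), k))) - (1 / 2) ^ k"
    then obtain k where "r < qrat (d (prod_encode (prod_encode (i, j), k))) - (1 / 2) ^ k" ..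
    with d(2)[of i j k] show "r < dist (a i) (a j)" by linarith
  qed
  then show ?thesis
    by (simp only:) (intro sem_intro rec_intro recursive_comp[OF d(1)] recursive_comp[OF assms(1)]
        recursive_comp[OF assms(2)] rational_recursive_comp[OF assms(3)])
qed

lemma dense_point: "0 < e \<Longrightarrow> \<exists>i. dist (a i) y < e"
proof -
  assume "0 < e"
  moreover have "y \<in> closure (range a)"
    using computable by (simp add: computable_probability_space_def computable_polish_space_def)
  ultimately show ?thesis by (auto simp: closure_approachable)
qed

section \<open>Uniformly effectively open families\<close>

definition effectively_open :: "(nat \<Rightarrow> 'a set) \<Rightarrow> bool" where
  "effectively_open U \<longleftrightarrow> (\<exists>f. recursive f \<and> (\<forall>n. U n = sigma01 a (f n)))"

named_theorems eo_intro

lemma effectively_openE: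
  assumes "effectively_open U"
  obtains f where "recursive f" "\<And>n. sigma01 a (f n) = U n"
  using assms unfolding effectively_open_def by auto

lemma effectively_open_sigma01 [eo_intro]:
  "recursive f \<Longrightarrow> effectively_open (\<lambda>n. sigma01 a (f n))"
  unfolding effectively_open_def by blast

lemma effectively_open_comp:
  assumes "effectively_open U" "recursive f" shows "effectively_open (\<lambda>n. U (f n))"
proof -
  obtain g where g: "recursive g" "\<And>n. sigma01 a (g n) = U n"
    using assms(1) by (rule effectively_openE) blast
  show ?thesis unfolding g(2)[symmetric] by (intro eo_intro recursive_comp[OF g(1) assms(2)])
qed

text \<open>A ball of radius 0 is empty, so the condition on the radius disappears from the
  union.\<close>

lemma sigma01_eq: "sigma01 a e = (\<Union>z\<in>W e. ball (a (pi1 z)) (qrat (pi2 z)))"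
proof (rule set_eqI)
  fix y
  have "y \<in> sigma01 a e \<longleftrightarrow> (\<exists>i k. prod_encode (i, k) \<in> W e \<and> y \<in> ball (a i) (qrat k))"
  proof -
    have "0 < qrat k" if "y \<in> ball (a i) (qrat k)" for i k
      using that le_less_trans[OF zero_le_dist] by auto
    then show ?thesis unfolding sigma01_def by blast
  qed
  also have "\<dots> \<longleftrightarrow> (\<exists>z\<in>W e. y \<in> ball (a (pi1 z)) (qrat (pi2 z)))"
    by (metis fst_conv snd_conv prod_encode_inverse prod.collapse prod_decode_inverse)
  finally show "y \<in> sigma01 a e \<longleftrightarrow> y \<in> (\<Union>z\<in>W e. ball (a (pi1 z)) (qrat (pi2 z)))" by simp
qed

lemma open_sigma01 [simp, intro]: "open (sigma01 a e)"
  by (auto simp: sigma01_eq)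

text \<open>The s-m-n theorem turns a semidecidable family of balls into a recursive sequence of
  indices.\<close>

lemma effectively_openI:
  assumes "semidecidable (\<lambda>z. P (pi1 z) (pi2 z))"
    "\<And>n. U n = (\<Union>z\<in>{z. P n z}. ball (a (pi1 z)) (qrat (pi2 z)))"
  shows "effectively_open U"
proof -
  obtain g where "recursive g" "\<And>n z. z \<in> W (g n) \<longleftrightarrow> P n z"
    using smn[OF assms(1)] by blast
  moreover from this(2) have "{z. P n z} = W (g n)" for n by auto
  ultimately show ?thesis
    unfolding effectively_open_def sigma01_eq by (auto simp: assms(2))
qed

lemma effectively_open_empty [eo_intro]: "effectively_open (\<lambda>_. {})"
  by (rule effectively_openI[of "\<lambda>_ _. False"]) (auto intro: sem_intro rec_intro)

lemma effectively_open_UNIV [eo_intro]: "effectively_open (\<lambda>_. UNIV)"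
proof (rule effectively_openI[of "\<lambda>_ _. True"])
  have "\<exists>z. y \<in> ball (a (pi1 z)) (qrat (pi2 z))" for y
  proof -
    obtain i where "dist (a i) y < 1" using dense_point by force
    moreover obtain k where "1 < qrat k" using qrat_dense[of 1 2] by auto
    ultimately show ?thesis by (intro exI[of _ "prod_encode (i, k)"]) simp
  qed
  then show "UNIV = (\<Union>z\<in>{z. True}. ball (a (pi1 z)) (qrat (pi2 z)))" by blast
qed (auto intro: sem_intro rec_intro)

lemma effectively_open_Union [eo_intro]:
  assumes "effectively_open (\<lambda>z. U (pi1 z) (pi2 z))" "semidecidable (\<lambda>z. P (pi1 z) (pi2 z))"
  shows "effectively_open (\<lambda>n. \<Union>y\<in>{y. P n y}. U n y)"
proof -
  obtain g where g: "recursive g" "\<And>z. sigma01 a (g z) = U (pi1 z) (pi2 z)"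
    using assms(1) by (rule effectively_openE) blast
  have U: "U n y = (\<Union>z\<in>W (g (prod_encode (n, y))). ball (a (pi1 z)) (qrat (pi2 z)))" for n y
    using g(2)[of "prod_encode (n, y)"] by (simp add: sigma01_eq)
  show ?thesis
    by (rule effectively_openI[of "\<lambda>n z. \<exists>y. P n y \<and> z \<in> W (g (prod_encode (n, y)))"])
       (intro sem_intro semidecidable_comp2[OF assms(2)] rec_intro recursive_comp[OF g(1)], auto simp: U)
qed

lemma effectively_open_Un [eo_intro]:
  assumes "effectively_open U" "effectively_open V" shows "effectively_open (\<lambda>n. U n \<union> V n)"
proof -
  obtain f where f: "recursive f" "\<And>n. sigma01 a (f n) = U n"
    using assms(1) by (rule effectively_openE) blast
  obtain g where g: "recursive g" "\<And>n. sigma01 a (g n) = V n"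
    using assms(2) by (rule effectively_openE) blast
  show ?thesis
    by (rule effectively_openI[of "\<lambda>n z. z \<in> W (f n) \<or> z \<in> W (g n)"])
       (intro sem_intro rec_intro recursive_comp[OF f(1)] recursive_comp[OF g(1)],
        auto simp: f(2)[symmetric] g(2)[symmetric] sigma01_eq)
qed

text \<open>\<open>F n\<close> may be negative and comes without a \<open>qrat\<close> code;
  exhausting the ball from inside by coded radii avoids both difficulties.\<close>

lemma effectively_open_ball [eo_intro]:
  assumes "recursive f" "rational_recursive F"
  shows "effectively_open (\<lambda>n. ball (a (f n)) (F n))"
proof (rule effectively_openI[of "\<lambda>n z. pi1 z = f n \<and> qrat (pi2 z) < F n"])
  show "semidecidable (\<lambda>z. pi1 (pi2 z) = f (pi1 z) \<and> qrat (pi2 (pi2 z)) < F (pi1 z))"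
    by (intro sem_intro rec_intro recursive_comp[OF assms(1)] rational_recursive_comp[OF assms(2)])
  fix n
  have "\<exists>z. pi1 z = f n \<and> qrat (pi2 z) < F n \<and> dist (a (f n)) y < qrat (pi2 z)"
    if lt: "dist (a (f n)) y < F n" for y
  proof -
    obtain k where "dist (a (f n)) y < qrat k" "qrat k < F n"
      using qrat_dense[OF _ lt] by auto
    then show ?thesis by (intro exI[of _ "prod_encode (f n, k)"]) simp
  qed
  then show "ball (a (f n)) (F n) =
      (\<Union>z\<in>{z. pi1 z = f n \<and> qrat (pi2 z) < F n}. ball (a (pi1 z)) (qrat (pi2 z)))"
    by fastforce
qed

lemma effectively_open_outside [eo_intro]:
  assumes "recursive f" "rational_recursive F"
  shows "effectively_open (\<lambda>n. {y. F n < dist (a (f n)) y})"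
proof (rule effectively_openI[of "\<lambda>n z. F n + qrat (pi2 z) < dist (a (f n)) (a (pi1 z))"])
  show "semidecidable (\<lambda>z. F (pi1 z) + qrat (pi2 (pi2 z)) < dist (a (f (pi1 z))) (a (pi1 (pi2 z))))"
    by (intro sem_intro rec_intro recursive_comp[OF assms(1)] rational_recursive_comp[OF assms(2)])
  fix n
  show "{y. F n < dist (a (f n)) y} =
      (\<Union>z\<in>{z. F n + qrat (pi2 z) < dist (a (f n)) (a (pi1 z))}. ball (a (pi1 z)) (qrat (pi2 z)))"
  proof (intro subset_antisym subsetI)
    fix y assume "y \<in> {y. F n < dist (a (f n)) y}"
    \<comment> \<open>A third of the gap: the centre is within \<open>e\<close> of \<open>y\<close>
      and the radius lies between \<open>e\<close> and \<open>2 * e\<close>, together less than the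
      gap.\<close>
    define e where "e = (dist (a (f n)) y - F n) / 3"
    then have "e > 0" using \<open>y \<in> _\<close> by simp
    obtain i where i: "dist (a i) y < e" using dense_point[OF \<open>e > 0\<close>] by blast
    obtain k where k: "e < qrat k" "qrat k < 2 * e" using qrat_dense[of e "2 * e"] \<open>e > 0\<close> by auto
    have "dist (a (f n)) y \<le> dist (a (f n)) (a i) + dist (a i) y" by (rule dist_triangle)
    then have "F n + qrat k < dist (a (f n)) (a i)" using i k unfolding e_def
      by (simp add: field_simps)
    with i k show "y \<in> (\<Union>z\<in>{z. F n + qrat (pi2 z) < dist (a (f n)) (a (pi1 z))}.
        ball (a (pi1 z)) (qrat (pi2 z)))"
      by (intro UN_I[of "prod_encode (i, k)"]) auto
  next
    fix y assume "y \<in> (\<Union>z\<in>{z. F n + qrat (pi2 z) < dist (a (f n)) (a (pi1 z))}.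
        ball (a (pi1 z)) (qrat (pi2 z)))"
    then obtain i k where "F n + qrat k < dist (a (f n)) (a i)" "dist (a i) y < qrat k" by auto
    moreover have "dist (a (f n)) (a i) \<le> dist (a (f n)) y + dist y (a i)" by (rule dist_triangle)
    ultimately show "y \<in> {y. F n < dist (a (f n)) y}" by (simp add: dist_commute)
  qed
qed

text \<open>Inclusion of balls is replaced by formal inclusion \<open>?in\<close>, a strict
  inequality between centres and radii. It is semidecidable and implies inclusion, and each point of
  the intersection has a small ball formally included in both given ones.\<close>

lemma effectively_open_Int [eo_intro]:
  assumes "effectively_open U" "effectively_open V" shows "effectively_open (\<lambda>n. U n \<inter> V n)"
proof -
  obtain f where f: "recursive f" "\<And>n. sigma01 a (f n) = U n"
    using assms(1) by (rule effectively_openE) blast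
  obtain g where g: "recursive g" "\<And>n. sigma01 a (g n) = V n"
    using assms(2) by (rule effectively_openE) blast
  let ?in = "\<lambda>z w. dist (a (pi1 z)) (a (pi1 w)) < qrat (pi2 w) - qrat (pi2 z)"
  have sub: "dist (a (pi1 w)) y < qrat (pi2 w)"
    if "?in z w" "dist (a (pi1 z)) y < qrat (pi2 z)" for z w y
    using that dist_triangle[of "a (pi1 w)" y "a (pi1 z)"] by (simp add: dist_commute)
  show ?thesis
  proof (rule effectively_openI[of "\<lambda>n z. \<exists>v w. v \<in> W (f n) \<and> w \<in> W (g n) \<and> ?in z v \<and> ?in z w"])
    show "semidecidable (\<lambda>y. \<exists>v w. v \<in> W (f (pi1 y)) \<and> w \<in> W (g (pi1 y)) \<and>
        ?in (pi2 y) v \<and> ?in (pi2 y) w)"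
      by (intro sem_intro rec_intro recursive_comp[OF f(1)] recursive_comp[OF g(1)])
    fix n
    show "U n \<inter> V n = (\<Union>z\<in>{z. \<exists>v w. v \<in> W (f n) \<and> w \<in> W (g n) \<and> ?in z v \<and> ?in z w}.
        ball (a (pi1 z)) (qrat (pi2 z)))"
    proof (intro subset_antisym subsetI)
      fix y assume "y \<in> U n \<inter> V n"
      then obtain v w where vw: "v \<in> W (f n)" "w \<in> W (g n)"
        "dist (a (pi1 v)) y < qrat (pi2 v)" "dist (a (pi1 w)) y < qrat (pi2 w)"
        unfolding f(2)[symmetric] g(2)[symmetric] sigma01_eq by auto
      define e where "e = min (qrat (pi2 v) - dist (a (pi1 v)) y) (qrat (pi2 w) - dist (a (pi1 w)) y) / 3"
      have "e > 0" using vw by (simp add: e_def)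
      have e: "3 * e \<le> qrat (pi2 v) - dist (a (pi1 v)) y" "3 * e \<le> qrat (pi2 w) - dist (a (pi1 w)) y"
        by (simp_all add: e_def)
      obtain i where i: "dist (a i) y < e" using dense_point[OF \<open>e > 0\<close>] by blast
      obtain k where k: "e < qrat k" "qrat k < 2 * e" using qrat_dense[of e "2 * e"] \<open>e > 0\<close> by auto
      have "dist (a i) (a (pi1 v)) < qrat (pi2 v) - qrat k"
        using e(1) i k dist_triangle[of "a i" "a (pi1 v)" y] by (simp add: dist_commute)
      moreover have "dist (a i) (a (pi1 w)) < qrat (pi2 w) - qrat k"
        using e(2) i k dist_triangle[of "a i" "a (pi1 w)" y] by (simp add: dist_commute)
      ultimately show "y \<in> (\<Union>z\<in>{z. \<exists>v w. v \<in> W (f n) \<and> w \<in> W (g n) \<and> ?in z v \<and> ?in z w}.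
        ball (a (pi1 z)) (qrat (pi2 z)))"
        using i k vw(1,2)
          by (intro UN_I[of "prod_encode (i, k)"] CollectI exI[of _ v] exI[of _ w]) auto
    next
      fix y assume "y \<in> (\<Union>z\<in>{z. \<exists>v w. v \<in> W (f n) \<and> w \<in> W (g n) \<and> ?in z v \<and> ?in z w}.
        ball (a (pi1 z)) (qrat (pi2 z)))"
      then obtain z v w where "v \<in> W (f n)" "w \<in> W (g n)" "?in z v" "?in z w"
        "dist (a (pi1 z)) y < qrat (pi2 z)" by auto
      with sub show "y \<in> U n \<inter> V n"
        unfolding f(2)[symmetric] g(2)[symmetric] sigma01_eq by auto
    qed
  qed
qed

lemma semidecidable_measure [sem_intro]:
  assumes "effectively_open U" "rational_recursive F"
  shows "semidecidable (\<lambda>x. F x < prob (U x))"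
proof -
  obtain f where f: "recursive f" "\<And>n. sigma01 a (f n) = U n"
    using assms(1) by (rule effectively_openE) blast
  have "semidecidable (\<lambda>z. z \<in> {prod_encode (e, k) | e k. qrat k < prob (sigma01 a e)})"
    using computable unfolding computable_probability_space_def lower_semicomputable_reals_def
      ce_iff_semidecidable by blast
  from semidecidable_comp[OF this recursive_pair]
  have m: "semidecidable (\<lambda>x. qrat (k x) < prob (sigma01 a (e x)))"
    if "recursive k" "recursive e" for k e
    using that by simp
  \<comment> \<open>Lower semicomputability only speaks about coded, hence nonnegative, rationals; a
    negative \<open>F x\<close> lies below every measure and is treated separately.\<close>
  have "F x < prob (U x) \<longleftrightarrow> F x < 0 \<or> (\<exists>k. F x \<le> qrat k \<and> qrat k < prob (sigma01 a (f x)))" for x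
    unfolding f(2)
    by (meson qrat_dense not_le less_imp_le less_le_trans measure_nonneg le_less_trans)
  then show ?thesis
    by (simp only:) (intro sem_intro m rec_intro assms(2) rational_recursive_comp[OF assms(2)]
        recursive_comp[OF f(1)])
qed

text \<open>The distribution of the distance to \<open>y\<close> has only countably many atoms, so
  some radius \<open>r\<close> in the interval has a null sphere. The closed annuli
  \<open>A k\<close> shrink to that sphere and their measures tend to 0; the rational radii are
  chosen inside a thin one.\<close>

lemma small_annulus:
  assumes "0 \<le> l" "l < u"
  obtains l' u' where "l < qrat l'" "qrat l' < qrat u'" "qrat u' < u"
    "1 - (1 / 2) ^ n < prob (ball y (qrat l') \<union> {w. qrat u' < dist y w})"
proof -
  have meas [measurable]: "dist y \<in> borel_measurable \<mu>"
    by (subst measurable_cong_sets[OF sets_mu refl]) (intro borel_measurable_continuous_onI continuous_intros)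
  interpret D: prob_space "distr \<mu> borel (dist y)" by (rule prob_space_distr) (rule meas)
  have "\<not> {l<..<u} \<subseteq> {r. D.prob {r} \<noteq> 0}"
    using countable_subset[OF _ D.countable_support] uncountable_open_interval[of l u] assms(2) by blast
  then obtain r where r: "l < r" "r < u" "D.prob {r} = 0" by auto
  define A where "A k = {w. \<bar>dist y w - r\<bar> \<le> 1 / Suc k}" for k :: nat
  have closed: "closed (A k)" for k
    unfolding A_def by (intro closed_Collect_le continuous_intros)
  have "(\<Inter>k. A k) = {w. dist y w = r}"
  proof (intro subset_antisym subsetI)
    fix w assume w: "w \<in> (\<Inter>k. A k)"
    have "\<not> 0 < \<bar>dist y w - r\<bar>"
    proof
      assume "0 < \<bar>dist y w - r\<bar>"
      then obtain k where "inverse (real (Suc k)) < \<bar>dist y w - r\<bar>" using reals_Archimedean by blast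
      moreover have "w \<in> A k" using w by blast
      ultimately show False unfolding A_def by (simp add: inverse_eq_divide)
    qed
    then show "w \<in> {w. dist y w = r}" by simp
  qed (auto simp: A_def)
  moreover have "prob {w. dist y w = r} = 0"
    using r(3) by (subst (asm) measure_distr) (auto simp: vimage_def)
  moreover have "(\<lambda>k. prob (A k)) \<longlonglongrightarrow> prob (\<Inter>k. A k)"
  proof (rule finite_Lim_measure_decseq)
    show "range A \<subseteq> events" using closed by (auto simp: sets_mu)
    show "decseq A" unfolding A_def decseq_def
      by (auto elim!: order_trans intro!: divide_left_mono)
  qed
  ultimately have "(\<lambda>k. prob (A k)) \<longlonglongrightarrow> 0" by simp
  then have "\<forall>\<^sub>F k in sequentially. prob (A k) < (1 / 2) ^ n" by (rule order_tendstoD) simp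
  moreover have "\<forall>\<^sub>F k in sequentially. 1 / real (Suc k) < min (r - l) (u - r)"
  proof (rule order_tendstoD)
    show "(\<lambda>k. 1 / real (Suc k)) \<longlonglongrightarrow> 0" using LIMSEQ_inverse_real_of_nat
      by (simp add: inverse_eq_divide)
  qed (use r in simp)
  ultimately have "\<forall>\<^sub>F k in sequentially. prob (A k) < (1 / 2) ^ n \<and> 1 / real (Suc k) < min (r - l) (u - r)"
    by (rule eventually_conj)
  then obtain k where k: "prob (A k) < (1 / 2) ^ n" "1 / real (Suc k) < min (r - l) (u - r)"
    using eventually_happens'[OF sequentially_bot] by blast
  have pos: "0 < 1 / real (Suc k)" by simp
  obtain l' where l': "r - 1 / real (Suc k) < qrat l'" "qrat l' < r"
    using qrat_dense[of "r - 1 / real (Suc k)" r] k(2) assms(1) pos by auto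
  obtain u' where u': "r < qrat u'" "qrat u' < r + 1 / real (Suc k)"
    using qrat_dense[of r "r + 1 / real (Suc k)"] r(1) assms(1) pos by auto
  have "- A k \<subseteq> ball y (qrat l') \<union> {w. qrat u' < dist y w}"
    using l'(1) u'(2) unfolding A_def by (auto simp: abs_le_iff)
  moreover have "open {w. qrat u' < dist y w}" by (intro open_Collect_less continuous_intros)
  ultimately have "prob (- A k) \<le> prob (ball y (qrat l') \<union> {w. qrat u' < dist y w})"
    by (intro finite_measure_mono) (auto simp: sets_mu)
  moreover have "prob (- A k) = 1 - prob (A k)"
    using prob_compl[of "A k"] closed by (simp add: Compl_eq_Diff_UNIV sets_mu)
  ultimately show ?thesis
    by (intro that[of l' u']) (use l' u' k r in auto)
qed

lemma ae_decidable_code_iff: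
  "ae_decidable_code a \<mu> c \<longleftrightarrow> sigma01 a (fst c) \<inter> sigma01 a (snd c) = {} \<and>
     prob (sigma01 a (fst c) \<union> sigma01 a (snd c)) = 1"
  by (simp add: ae_decidable_code_def ae_set_def)

text \<open>The radii of the balls are limits of nested rational intervals whose annuli have vanishing
  measure, so the sphere between the two sets is null.\<close>

lemma ae_decidable_balls:
  obtains b where "recursive b"
    "\<And>z. ae_decidable_code a \<mu> (prod_decode (b z))"
    "\<And>i l u. sigma01 a (pi1 (b (prod_encode (i, prod_encode (l, u))))) \<subseteq> ball (a i) (qrat u)"
    "\<And>i l u. qrat l < qrat u \<Longrightarrow>
       cball (a i) (qrat l) \<subseteq> sigma01 a (pi1 (b (prod_encode (i, prod_encode (l, u)))))"
    "\<And>i l u. - ball (a i) (qrat u) \<subseteq> sigma01 a (pi2 (b (prod_encode (i, prod_encode (l, u)))))"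
proof -
  define outside where "outside i u = {w. qrat u < dist (a i) w}" for i u
  \<comment> \<open>\<open>s\<close> and \<open>t\<close> code intervals of radii, \<open>t\<close>
    refining \<open>s\<close>. The first disjunct lets every \<open>s\<close> have a successor, even
    an empty interval, as \<open>recursive_selection\<close> demands.\<close>
  define R where "R i n s t \<longleftrightarrow> \<not> qrat (pi1 s) < qrat (pi2 s) \<or>
     qrat (pi1 s) < qrat (pi1 t) \<and> qrat (pi1 t) < qrat (pi2 t) \<and> qrat (pi2 t) < qrat (pi2 s) \<and>
     1 - (1 / 2) ^ n < prob (ball (a i) (qrat (pi1 t)) \<union> outside i (pi2 t))" for i n s t
  have "semidecidable (\<lambda>z. R (pi1 (pi1 z)) (pi1 (pi2 (pi1 z))) (pi2 (pi2 (pi1 z))) (pi2 z))"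
    unfolding R_def outside_def by (intro sem_intro eo_intro rec_intro)
  moreover have "\<exists>t. R i n s t" for i n s
  proof (cases "qrat (pi1 s) < qrat (pi2 s)")
    case True
    obtain l' u' where "qrat (pi1 s) < qrat l'" "qrat l' < qrat u'" "qrat u' < qrat (pi2 s)"
      "1 - (1 / 2) ^ n < prob (ball (a i) (qrat l') \<union> {w. qrat u' < dist (a i) w})"
      using small_annulus[OF qrat_nonneg True] by metis
    then show ?thesis unfolding R_def outside_def by (intro exI[of _ "prod_encode (l', u')"]) simp
  qed (auto simp: R_def)
  ultimately obtain f where f: "recursive f" "\<And>z. R (pi1 z) (pi1 (pi2 z)) (pi2 (pi2 z)) (f z)"
    by (rule recursive_selection[where R = "\<lambda>x. R (pi1 x) (pi1 (pi2 x)) (pi2 (pi2 x))"]) blast+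
  define I where "I z n = rec_nat (pi2 z) (\<lambda>m s. f (prod_encode (pi1 z, prod_encode (m, s)))) n"
    for z n
  have I_Suc: "R (pi1 z) n (I z n) (I z (Suc n))" for z n
    using f(2)[of "prod_encode (pi1 z, prod_encode (n, I z n))"] by (simp add: I_def)
  have I: "recursive (\<lambda>x. I (g x) (h x))" if "recursive g" "recursive h" for g h
    unfolding I_def by (intro rec_intro recursive_comp[OF f(1)] that recursive_comp[OF that(1)])
  define valid where "valid z \<longleftrightarrow> qrat (pi1 (pi2 z)) < qrat (pi2 (pi2 z))" for z
  \<comment> \<open>The index set \<open>{n. valid z}\<close> is everything or nothing, which builds
    a condition into an effective union. An invalid interval yields the empty set with complement
    \<open>UNIV\<close>, so each \<open>z\<close> gives an almost everywhere decidable set.\<close>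
  define U where "U z = (\<Union>n\<in>{n. valid z}. ball (a (pi1 z)) (qrat (pi1 (I z n))))" for z
  define V where "V z = (\<Union>n\<in>{n. valid z}. outside (pi1 z) (pi2 (I z n))) \<union>
      (\<Union>n\<in>{n::nat. \<not> valid z}. UNIV)" for z
  have "effectively_open U"
    unfolding U_def valid_def by (intro eo_intro sem_intro rec_intro I)
  then obtain u where u: "recursive u" "\<And>z. sigma01 a (u z) = U z"
    by (rule effectively_openE) blast
  have "effectively_open V"
    unfolding V_def valid_def outside_def by (intro eo_intro sem_intro rec_intro I)
  then obtain v where v: "recursive v" "\<And>z. sigma01 a (v z) = V z"
    by (rule effectively_openE) blast
  have lt: "qrat (pi1 (I z n)) < qrat (pi2 (I z n))" if "valid z" for z n
  proof (induction n)
    case 0 show ?case using that by (simp add: valid_def I_def)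
  next
    case (Suc n) with I_Suc[of z n] show ?case by (simp add: R_def)
  qed
  have step: "qrat (pi1 (I z n)) < qrat (pi1 (I z (Suc n)))"
    "qrat (pi2 (I z (Suc n))) < qrat (pi2 (I z n))"
    "1 - (1 / 2) ^ n < prob (ball (a (pi1 z)) (qrat (pi1 (I z (Suc n)))) \<union>
       outside (pi1 z) (pi2 (I z (Suc n))))" if "valid z" for z n
    using I_Suc[of z n] lt[OF that, of n] by (simp_all add: R_def)
  have lower: "qrat (pi1 (I z m)) \<le> qrat (pi1 (I z n))" if "valid z" "m \<le> n" for z m n
    using lift_Suc_mono_le[of "\<lambda>n. qrat (pi1 (I z n))"] step(1)[OF that(1)] that(2)
    by (simp add: less_imp_le)
  have upper: "qrat (pi2 (I z n)) \<le> qrat (pi2 (I z m))" if "valid z" "m \<le> n" for z m n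
    using lift_Suc_antimono_le[of "\<lambda>n. qrat (pi2 (I z n))"] step(2)[OF that(1)] that(2)
    by (simp add: less_imp_le)
  have cross: "qrat (pi1 (I z m)) < qrat (pi2 (I z n))" if "valid z" for z m n
    using lower[OF that, of m "max m n"] upper[OF that, of n "max m n"] lt[OF that, of "max m n"]
    by linarith
  have open_outside: "open (outside i k)" for i k
    unfolding outside_def by (intro open_Collect_less continuous_intros)
  have disj: "U z \<inter> V z = {}" for z
    using cross[of z] unfolding U_def V_def outside_def by (fastforce dest: less_trans)
  have full: "prob (U z \<union> V z) = 1" for z
  proof (cases "valid z")
    case True
    have open_UV: "open (U z \<union> V z)" using open_outside unfolding U_def V_def by auto
    have "1 \<le> prob (U z \<union> V z) + (1 / 2) ^ n" for n
    proof -
      have "ball (a (pi1 z)) (qrat (pi1 (I z (Suc n)))) \<union> outside (pi1 z) (pi2 (I z (Suc n)))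
          \<subseteq> U z \<union> V z"
        using True unfolding U_def V_def by blast
      then have "prob (ball (a (pi1 z)) (qrat (pi1 (I z (Suc n)))) \<union>
          outside (pi1 z) (pi2 (I z (Suc n)))) \<le> prob (U z \<union> V z)"
        by (rule finite_measure_mono) (use open_UV in auto)
      with step(3)[OF True, of n] show ?thesis by linarith
    qed
    moreover have "(\<lambda>n. prob (U z \<union> V z) + (1 / 2) ^ n) \<longlonglongrightarrow> prob (U z \<union> V z) + 0"
      by (intro tendsto_add tendsto_const LIMSEQ_power_zero) simp
    ultimately have "1 \<le> prob (U z \<union> V z)" by (intro LIMSEQ_le_const) auto
    then show ?thesis by (simp add: antisym)
  next
    case False
    then have "U z \<union> V z = UNIV" by (auto simp: V_def)
    then show ?thesis using prob_space by simp
  qed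
  show ?thesis
  proof (rule that)
    show "recursive (\<lambda>z. prod_encode (u z, v z))" by (intro rec_intro u v)
    show "ae_decidable_code a \<mu> (prod_decode (prod_encode (u z, v z)))" for z
      using disj full by (simp add: ae_decidable_code_iff u(2) v(2))
    fix i l k
    let ?z = "prod_encode (i, prod_encode (l, k))"
    have I0: "pi1 (I ?z 0) = l" "pi2 (I ?z 0) = k" by (simp_all add: I_def)
    show "sigma01 a (pi1 (prod_encode (u ?z, v ?z))) \<subseteq> ball (a i) (qrat k)"
    proof
      fix w assume "w \<in> sigma01 a (pi1 (prod_encode (u ?z, v ?z)))"
      then obtain n where "valid ?z" "dist (a i) w < qrat (pi1 (I ?z n))"
        by (auto simp: u(2) U_def split: if_splits)
      with cross[of ?z n 0] show "w \<in> ball (a i) (qrat k)" by (simp add: I0)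
    qed
    show "- ball (a i) (qrat k) \<subseteq> sigma01 a (pi2 (prod_encode (u ?z, v ?z)))"
    proof (cases "valid ?z")
      case True
      \<comment> \<open>Stage 1 already lies strictly inside the given interval, so points at
        distance exactly \<open>qrat k\<close> belong to the complement as well.\<close>
      with step(2)[OF True, of 0] show ?thesis
        by (auto simp: v(2) V_def I0 outside_def not_less
            intro!: exI[of _ "Suc 0"] intro: less_le_trans)
    qed (auto simp: v(2) V_def)
    show "cball (a i) (qrat l) \<subseteq> sigma01 a (pi1 (prod_encode (u ?z, v ?z)))" if "qrat l < qrat k"
    proof -
      have "valid ?z" using that by (simp add: valid_def)
      with step(1)[OF this, of 0] show ?thesis
        by (auto simp: u(2) U_def I0 intro!: exI[of _ "Suc 0"] intro: le_less_trans)
    qed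
  qed
qed

text \<open>Positivity of a measure is only semidecidable, so the search for a lower bound is cut
  off after \<open>m\<close> steps. The value 0 means that no bound has been found yet, and a bound
  once found is frozen.\<close>

lemma recursive_level:
  obtains level where "recursive (\<lambda>z. level (pi1 z) (pi2 z))"
    "\<And>e m m'. level e m \<noteq> 0 \<Longrightarrow> m \<le> m' \<Longrightarrow> level e m' = level e m"
    "\<And>e m n. level e m = Suc n \<Longrightarrow> 2 * (1 / 2) ^ n \<le> prob (sigma01 a e)"
    "\<And>e. 0 < prob (sigma01 a e) \<Longrightarrow> \<exists>m. level e m \<noteq> (0::nat)"
proof -
  have "semidecidable (\<lambda>z. (1 / 2) ^ pi2 z < prob (sigma01 a (pi1 z)))"
    by (intro sem_intro eo_intro rec_intro)
  then obtain D where D: "decidable (\<lambda>z. D (pi1 z) (pi2 z))"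
      "\<And>z. (1 / 2) ^ pi2 z < prob (sigma01 a (pi1 z)) \<longleftrightarrow> (\<exists>t. D z t)"
    by (rule semidecidableE) blast
  have D_iff: "(1 / 2) ^ k < prob (sigma01 a e) \<longleftrightarrow> (\<exists>t. D (prod_encode (e, k)) t)" for e k
    using D(2)[of "prod_encode (e, k)"] by simp
  \<comment> \<open>Step \<open>m\<close> tests the exponent and the witness coded by
    \<open>m\<close>. A bound \<open>(1 / 2) ^ k\<close> is reported as \<open>Suc n\<close> with
    \<open>n = Suc k\<close>; this additional halving is the factor 2 in the third property.\<close>
  define level where "level e m = rec_nat 0 (\<lambda>m r. if r = 0 then
      (if D (prod_encode (e, pi1 m)) (pi2 m) then Suc (Suc (pi1 m)) else 0) else r) m" for e m
  have level_Suc: "level e (Suc m) = (if level e m = 0 then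
      (if D (prod_encode (e, pi1 m)) (pi2 m) then Suc (Suc (pi1 m)) else 0) else level e m)" for e m
    by (simp add: level_def)
  show ?thesis
  proof (rule that)
    show "recursive (\<lambda>z. level (pi1 z) (pi2 z))"
      unfolding level_def by (intro rec_intro decidable_comp2[OF D(1)])
    show "level e m' = level e m" if "level e m \<noteq> 0" "m \<le> m'" for e m m'
      using that(2,1) by (induction rule: dec_induct) (auto simp: level_Suc)
    show "2 * (1 / 2) ^ n \<le> prob (sigma01 a e)" if "level e m = Suc n" for e m n
      using that
    proof (induction m)
      case 0 then show ?case by (simp add: level_def)
    next
      case (Suc m)
      show ?case
      proof (cases "level e m = 0")
        case True
        with Suc.prems have "D (prod_encode (e, pi1 m)) (pi2 m)" "n = Suc (pi1 m)"
          by (auto simp: level_Suc split: if_splits)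
        with D_iff[of "pi1 m" e] show ?thesis by auto
      next
        case False with Suc show ?thesis by (simp add: level_Suc)
      qed
    qed
    show "\<exists>m. level e m \<noteq> 0" if pos: "0 < prob (sigma01 a e)" for e
    proof -
      obtain k t where "D (prod_encode (e, k)) t" using half_power_less[OF pos] D_iff by blast
      then have "level e (Suc (prod_encode (k, t))) \<noteq> 0" by (simp add: level_Suc)
      then show ?thesis ..
    qed
  qed
qed

end

section \<open>Betting on a sequence of queries\<close>

lemma qrat_between: "0 \<le> x \<Longrightarrow> x < y \<longleftrightarrow> (\<exists>k. x < qrat k \<and> qrat k < y)"
  by (meson qrat_dense less_trans)

text \<open>The capital mixes the measures \<open>b\<close> of the base and \<open>s\<close> of the
  cell. A rational between \<open>C * b\<close> and \<open>(2 * C - q) * s\<close> separates them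
  into an upper bound for \<open>b\<close> and a lower bound for \<open>s\<close>, each of which can
  be enumerated.\<close>

lemma doubling_greater_iff:
  fixes b s C q :: real
  assumes "0 < b" "0 < s" "0 < C"
  shows "q < C * (2 - b / s) \<longleftrightarrow>
    (\<exists>p. 0 < 2 * C - q \<and> b < qrat p / C \<and> qrat p / (2 * C - q) < s)"
proof -
  have "q < C * (2 - b / s) \<longleftrightarrow> C * b < (2 * C - q) * s"
    using assms by (simp add: field_simps)
  also have "\<dots> \<longleftrightarrow> (\<exists>p. 0 < 2 * C - q \<and> C * b < qrat p \<and> qrat p < (2 * C - q) * s)"
  proof
    assume *: "C * b < (2 * C - q) * s"
    have "0 < (2 * C - q) * s" using assms by (intro less_trans[OF _ *]) simp
    then have "0 < 2 * C - q" using assms(2) by (simp add: zero_less_mult_iff)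
    moreover obtain p where "C * b < qrat p" "qrat p < (2 * C - q) * s"
      using qrat_dense[OF _ *] assms by auto
    ultimately show "\<exists>p. 0 < 2 * C - q \<and> C * b < qrat p \<and> qrat p < (2 * C - q) * s" by blast
  qed auto
  also have "\<dots> \<longleftrightarrow> (\<exists>p. 0 < 2 * C - q \<and> b < qrat p / C \<and> qrat p / (2 * C - q) < s)"
    using assms by (auto simp: pos_less_divide_eq pos_divide_less_eq mult.commute)
  finally show ?thesis .
qed

text \<open>The same separation with the roles of upper and lower bound exchanged. If
  \<open>q\<close> is at least \<open>2 * C\<close> the inequality holds outright, since
  \<open>b / s\<close> is positive.\<close>

lemma doubling_less_iff:
  fixes b s C q :: real
  assumes "0 < b" "0 < s" "0 < C"
  shows "C * (2 - b / s) < q \<longleftrightarrow> 2 * C - q \<le> 0 \<or>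
    (\<exists>p. 0 < 2 * C - q \<and> s < qrat p / (2 * C - q) \<and> qrat p / C < b)"
proof -
  have "C * (2 - b / s) * s = 2 * C * s - C * b" using assms by (simp add: algebra_simps)
  then have "C * (2 - b / s) < q \<longleftrightarrow> (2 * C - q) * s < C * b"
    using mult_less_cancel_right_pos[OF assms(2), of "C * (2 - b / s)" q]
      by (simp add: left_diff_distrib) linarith
  also have "\<dots> \<longleftrightarrow> 2 * C - q \<le> 0 \<or>
      (\<exists>p. 0 < 2 * C - q \<and> (2 * C - q) * s < qrat p \<and> qrat p < C * b)"
  proof (cases "2 * C - q \<le> 0")
    case True
    then have "(2 * C - q) * s \<le> 0" using assms by (simp add: mult_le_0_iff)
    also have "0 < C * b" using assms by simp
    finally show ?thesis using True by simp
  next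
    case False
    then have "0 < 2 * C - q" "0 \<le> (2 * C - q) * s" using assms by simp_all
    with qrat_between[OF this(2)] False show ?thesis by blast
  qed
  also have "\<dots> \<longleftrightarrow> 2 * C - q \<le> 0 \<or>
      (\<exists>p. 0 < 2 * C - q \<and> s < qrat p / (2 * C - q) \<and> qrat p / C < b)"
    using assms by (auto simp: pos_less_divide_eq pos_divide_less_eq mult.commute)
  finally show ?thesis .
qed

section \<open>Almost everywhere decidable sets coded by single numbers\<close>

locale coded_sets = computable_space +
  fixes inter union :: "nat \<Rightarrow> nat \<Rightarrow> nat" and empty univ :: nat
  assumes inter: "recursive (\<lambda>z. inter (pi1 z) (pi2 z))"
      "\<And>d e. sigma01 a (inter d e) = sigma01 a d \<inter> sigma01 a e"
    and union: "recursive (\<lambda>z. union (pi1 z) (pi2 z))"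
      "\<And>d e. sigma01 a (union d e) = sigma01 a d \<union> sigma01 a e"
    and empty: "sigma01 a empty = {}"
    and univ: "sigma01 a univ = UNIV"
begin

abbreviation inside :: "nat \<Rightarrow> 'a set" where "inside P \<equiv> sigma01 a (pi1 P)"
abbreviation outside :: "nat \<Rightarrow> 'a set" where "outside P \<equiv> sigma01 a (pi2 P)"

definition meet :: "nat \<Rightarrow> nat \<Rightarrow> nat" where
  "meet P Q = prod_encode (inter (pi1 P) (pi1 Q), union (pi2 P) (pi2 Q))"

definition compl_code :: "nat \<Rightarrow> nat" where
  "compl_code Q = prod_encode (pi2 Q, pi1 Q)"

lemma recursive_meet [rec_intro]:
  "recursive f \<Longrightarrow> recursive g \<Longrightarrow> recursive (\<lambda>x. meet (f x) (g x))"
  unfolding meet_def by (intro rec_intro recursive_comp2[OF inter(1)] recursive_comp2[OF union(1)])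

lemma meet_simps [simp]:
  "inside (meet P Q) = inside P \<inter> inside Q" "outside (meet P Q) = outside P \<union> outside Q"
  by (simp_all add: meet_def inter(2) union(2))

lemma compl_code_simps [simp]:
  "inside (compl_code Q) = outside Q" "outside (compl_code Q) = inside Q"
  by (simp_all add: compl_code_def)

definition ae_decidable :: "nat \<Rightarrow> bool" where "ae_decidable P \<longleftrightarrow> ae_decidable_code a \<mu> (prod_decode P)"

lemma ae_decidable_iff:
  "ae_decidable P \<longleftrightarrow> inside P \<inter> outside P = {} \<and> (AE y in \<mu>. y \<in> inside P \<union> outside P)"
  unfolding ae_decidable_def ae_decidable_code_iff by (subst prob_eq_1) simp_all

lemma ae_decidable_meet: "ae_decidable P \<Longrightarrow> ae_decidable Q \<Longrightarrow> ae_decidable (meet P Q)"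
  unfolding ae_decidable_iff by auto

lemma ae_decidable_compl: "ae_decidable P \<Longrightarrow> ae_decidable (compl_code P)"
  unfolding ae_decidable_iff by (auto simp: Un_commute)

text \<open>The source of upper bounds: measures of open sets are enumerated from below only, and
  here the measure of \<open>inside P\<close> is bounded from above through
  \<open>outside P\<close>.\<close>

lemma prob_outside: "ae_decidable P \<Longrightarrow> prob (outside P) = 1 - prob (inside P)"
  using finite_measure_Union[of "inside P" "outside P"]
  by (simp add: ae_decidable_def ae_decidable_code_iff)

lemma prob_split:
  assumes "ae_decidable P" "U \<in> events"
  shows "prob (U \<inter> inside P) + prob (U \<inter> outside P) = prob U"
proof -
  have "prob (U \<inter> inside P) + prob (U \<inter> outside P) = prob (U \<inter> inside P \<union> U \<inter> outside P)"
    using assms by (intro finite_measure_Union[symmetric]) (auto simp: ae_decidable_iff)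
  also have "\<dots> = prob U"
    using assms by (intro finite_measure_eq_AE) (auto simp: ae_decidable_iff)
  finally show ?thesis .
qed

end

text \<open>The queries of level \<open>n\<close> are asked one after the other until one is answered positively. At
  this point the capital has doubled, and the strategy passes to a level at which the queries cover
  at most half of the current cell, called the base. While the measure of the base has not yet been
  bounded from below, trivial queries are asked.\<close>

locale betting_machine = coded_sets +
  fixes level q :: "nat \<Rightarrow> nat \<Rightarrow> nat"
  assumes level: "recursive (\<lambda>z. level (pi1 z) (pi2 z))"
      "\<And>e m m'. level e m \<noteq> 0 \<Longrightarrow> m \<le> m' \<Longrightarrow> level e m' = level e m"
      "\<And>e m n. level e m = Suc n \<Longrightarrow> 2 * (1 / 2) ^ n \<le> measure \<mu> (sigma01 a e)"
      "\<And>e. 0 < measure \<mu> (sigma01 a e) \<Longrightarrow> \<exists>m. level e m \<noteq> 0"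
    and q: "recursive (\<lambda>z. q (pi1 z) (pi2 z))"
      "\<And>n m. ae_decidable_code a \<mu> (prod_decode (q n m))"
      "\<And>n. measure \<mu> (\<Union>m. sigma01 a (pi1 (q n m))) \<le> (1 / 2) ^ n"
begin

text \<open>While the level is unknown, the query has an empty positive part and every point answers
  no. The list \<open>q n\<close> is entered at the current time and not at its beginning, so
  entries may be skipped; this is why hits will be required at arbitrarily late positions.\<close>

definition query :: "nat \<Rightarrow> nat \<Rightarrow> nat" where
  "query b m = (if level b m = 0 then prod_encode (empty, univ) else q (level b m - 1) m)"

abbreviation cell_code :: "nat \<Rightarrow> nat" where "cell_code s \<equiv> pi1 s"
abbreviation base_code :: "nat \<Rightarrow> nat" where "base_code s \<equiv> pi1 (pi2 s)"
abbreviation time :: "nat \<Rightarrow> nat" where "time s \<equiv> pi1 (pi2 (pi2 s))"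
abbreviation wins :: "nat \<Rightarrow> nat" where "wins s \<equiv> pi2 (pi2 (pi2 s))"

definition ask :: "nat \<Rightarrow> nat" where "ask s = query (pi1 (base_code s)) (time s)"

definition lose :: "nat \<Rightarrow> nat" where
  "lose s = prod_encode (meet (cell_code s) (compl_code (ask s)),
     prod_encode (base_code s, prod_encode (Suc (time s), wins s)))"

definition win :: "nat \<Rightarrow> nat" where
  "win s = prod_encode (meet (cell_code s) (ask s),
     prod_encode (meet (cell_code s) (ask s), prod_encode (0, Suc (wins s))))"

definition start :: nat where
  "start = prod_encode (prod_encode (univ, empty),
     prod_encode (prod_encode (univ, empty), prod_encode (0, 0)))"

definition run :: "nat \<Rightarrow> nat" where
  "run y = foldl (\<lambda>s b. if b = 0 then lose s else win s) start (list_decode y)"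

abbreviation state :: "bool list \<Rightarrow> nat" where "state \<sigma> \<equiv> run (string_code \<sigma>)"

definition strategy :: "bool list \<Rightarrow> nat \<times> nat" where
  "strategy \<sigma> = prod_decode (ask (state \<sigma>))"

definition capital :: "bool list \<Rightarrow> real option" where
  "capital \<sigma> = (let s = state \<sigma> in
     if 0 < prob (inside (cell_code s))
     then Some (2 ^ wins s * (2 - prob (inside (base_code s)) / prob (inside (cell_code s))))
     else None)"

lemma state_Nil: "state [] = start"
  by (simp add: run_def string_code_def)

lemma state_snoc: "state (\<sigma> @ [b]) = (if b then win (state \<sigma>) else lose (state \<sigma>))"
  by (simp add: run_def string_code_def del: list_encode.simps)

lemma recursive_query [rec_intro]:
  "recursive f \<Longrightarrow> recursive g \<Longrightarrow> recursive (\<lambda>x. query (f x) (g x))"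
  unfolding query_def by (intro rec_intro recursive_comp2[OF level(1)] recursive_comp2[OF q(1)])

lemma recursive_ask [rec_intro]: "recursive f \<Longrightarrow> recursive (\<lambda>x. ask (f x))"
  unfolding ask_def by (intro rec_intro)

lemma recursive_run: "recursive run"
  unfolding run_def lose_def win_def compl_code_def
  by (intro recursive_foldl rec_intro)

lemma start_simps [simp]:
  "inside (cell_code start) = UNIV" "outside (cell_code start) = {}"
  "inside (base_code start) = UNIV" "outside (base_code start) = {}" "time start = 0"
  by (simp_all add: start_def empty univ)

lemma win_simps [simp]:
  "cell_code (win s) = meet (cell_code s) (ask s)" "base_code (win s) = meet (cell_code s) (ask s)"
  "time (win s) = 0" "wins (win s) = Suc (wins s)"
  by (simp_all add: win_def)

lemma lose_simps [simp]:
  "cell_code (lose s) = meet (cell_code s) (compl_code (ask s))"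
  "base_code (lose s) = base_code s" "time (lose s) = Suc (time s)" "wins (lose s) = wins s"
  by (simp_all add: lose_def)

text \<open>Ties the codes kept in the state to the derived family, so that the requirements on a
  strategy can be checked on states.\<close>

lemma cell_eq:
  "cell (\<lambda>\<tau>. ae_set a (strategy \<tau>)) \<sigma> = (inside (cell_code (state \<sigma>)), outside (cell_code (state \<sigma>)))"
proof (induction \<sigma> rule: rev_induct)
  case (snoc b \<sigma>)
  then show ?case
    by (cases b) (simp_all add: cell_snoc_True cell_snoc_False ae_inter_def ae_compl_def ae_set_def
        strategy_def state_snoc)
qed (simp add: cell_Nil state_Nil)

lemma ae_decidable_query: "ae_decidable (query b m)"
  using q(2) prob_space by (auto simp: query_def ae_decidable_def ae_decidable_code_iff empty univ)

lemma ae_decidable_state: "ae_decidable (cell_code (state \<sigma>)) \<and> ae_decidable (base_code (state \<sigma>))"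
proof (induction \<sigma> rule: rev_induct)
  case Nil show ?case by (simp add: state_Nil ae_decidable_iff)
next
  case (snoc b \<sigma>)
  then show ?case
    by (cases b) (simp_all add: state_snoc ask_def ae_decidable_meet ae_decidable_compl ae_decidable_query)
qed

text \<open>A win resets base and time, so the cell differs from the base only by the negative
  answers at the times since the last win.\<close>

lemma inside_cell:
  "inside (cell_code (state \<sigma>)) = inside (base_code (state \<sigma>)) \<inter>
     (\<Inter>i<time (state \<sigma>). outside (query (pi1 (base_code (state \<sigma>))) i))"
proof (induction \<sigma> rule: rev_induct)
  case Nil show ?case by (simp add: state_Nil)
next
  case (snoc b \<sigma>)
  then show ?case
    by (cases b) (auto simp: state_snoc ask_def lessThan_Suc)
qed

text \<open>The level is frozen once known, so all nontrivial queries belong to one level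
  \<open>n\<close>. Their union has measure at most \<open>(1 / 2) ^ n\<close>, and \<open>n\<close>
  was reported only because the base has twice this measure.\<close>

lemma prob_queries:
  "2 * prob (\<Union>i<k. inside (query b i)) \<le> prob (sigma01 a b)"
proof (cases "\<exists>i<k. level b i \<noteq> 0")
  case False
  then have "(\<Union>i<k. inside (query b i)) = {}" by (simp add: query_def empty)
  then show ?thesis by simp
next
  case True
  then obtain i n where i: "level b i = Suc n" by (meson not0_implies_Suc)
  have levels: "level b m = 0 \<or> level b m = Suc n" for m
    using level(2)[of b i m] level(2)[of b m i] i by (metis nat.distinct(1) nle_le)
  have "inside (query b m) \<subseteq> (\<Union>m. inside (q n m))" for m
    using levels[of m] by (auto simp: query_def empty)
  then have "prob (\<Union>i<k. inside (query b i)) \<le> prob (\<Union>m. inside (q n m))"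
    by (intro finite_measure_mono) auto
  also have "\<dots> \<le> (1 / 2) ^ n" by (rule q(3))
  finally show ?thesis using level(3)[OF i] by simp
qed

text \<open>Almost every point of the base lies in the cell or in the positive part of some query
  asked; the latter part is at most half of the base. This keeps the capital nonnegative.\<close>

lemma prob_base_le: "prob (inside (base_code (state \<sigma>))) \<le> 2 * prob (inside (cell_code (state \<sigma>)))"
proof -
  let ?b = "base_code (state \<sigma>)" and ?c = "cell_code (state \<sigma>)"
  let ?Q = "\<Union>i<time (state \<sigma>). inside (query (pi1 ?b) i)"
  have "AE y in \<mu>. \<forall>i. y \<in> inside (query (pi1 ?b) i) \<union> outside (query (pi1 ?b) i)"
    using ae_decidable_query unfolding ae_decidable_iff by (simp add: AE_all_countable)
  then have "AE y in \<mu>. y \<in> inside ?b \<longrightarrow> y \<in> inside ?c \<union> ?Q"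
    unfolding inside_cell[of \<sigma>] by eventually_elim auto
  then have "prob (inside ?b) \<le> prob (inside ?c \<union> ?Q)" by (intro finite_measure_mono_AE) auto
  also have "\<dots> \<le> prob (inside ?c) + prob ?Q" by (intro measure_Un_le) auto
  finally show ?thesis using prob_queries[of "pi1 ?b" "time (state \<sigma>)"] by linarith
qed

lemma prob_cell_le: "prob (inside (cell_code (state \<sigma>))) \<le> prob (inside (base_code (state \<sigma>)))"
  unfolding inside_cell[of \<sigma>] by (intro finite_measure_mono) auto

lemma capital_nonneg: "capital \<sigma> = Some y \<Longrightarrow> 0 \<le> y"
  using prob_base_le[of \<sigma>]
  by (auto simp: capital_def Let_def pos_divide_le_eq split: if_splits intro!: mult_nonneg_nonneg)

text \<open>The formula persists on null cells: there the base is null by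
  \<open>prob_base_le\<close>, so both sides vanish. Fairness thus becomes a linear identity without
  case distinctions.\<close>

lemma stake_capital:
  "stake (capital \<sigma>) (prob (inside (cell_code (state \<sigma>)))) =
     2 ^ wins (state \<sigma>) * (2 * prob (inside (cell_code (state \<sigma>))) - prob (inside (base_code (state \<sigma>))))"
proof (cases "0 < prob (inside (cell_code (state \<sigma>)))")
  case True
  then show ?thesis by (simp add: stake_def capital_def Let_def algebra_simps)
next
  case False
  then have "prob (inside (cell_code (state \<sigma>))) = 0" by (simp add: zero_less_measure_iff)
  moreover from this prob_base_le[of \<sigma>] have "prob (inside (base_code (state \<sigma>))) = 0"
    by (simp add: measure_le_0_iff)
  ultimately show ?thesis by (simp add: stake_def capital_def Let_def)
qed

lemma capital_computable: "partial_computable_capital capital"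
proof -
  \<comment> \<open>\<open>R\<close> says that the capital lies strictly between \<open>lo\<close>
    and \<open>hi\<close>, using lower bounds for measures only;
    \<open>1 - qrat p / C < prob (outside (base_code s))\<close> stands for
    \<open>prob (inside (base_code s)) < qrat p / C\<close>. The first conjunct makes the search
    diverge on null cells.\<close>
  define R where "R y k v \<longleftrightarrow> (let s = run y; C = 2 ^ wins s;
        lo = qrat v - (1 / 2) ^ k; hi = qrat v + (1 / 2) ^ k in
      0 < prob (inside (cell_code s)) \<and>
      (\<exists>p. 0 < 2 * C - lo \<and> 1 - qrat p / C < prob (outside (base_code s)) \<and>
         qrat p / (2 * C - lo) < prob (inside (cell_code s))) \<and>
      (2 * C - hi \<le> 0 \<or> (\<exists>p. 0 < 2 * C - hi \<and>
         1 - qrat p / (2 * C - hi) < prob (outside (cell_code s)) \<and>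
         qrat p / C < prob (inside (base_code s)))))" for y k v
  have "semidecidable (\<lambda>z. R (pi1 (pi1 z)) (pi2 (pi1 z)) (pi2 z))"
    unfolding R_def Let_def
    by (intro sem_intro eo_intro rec_intro recursive_comp[OF recursive_run])
  then obtain f where f: "partial_recursive f" "\<And>z v. f z = Some v \<Longrightarrow> R (pi1 z) (pi2 z) v"
    "\<And>z. f z = None \<longleftrightarrow> (\<nexists>v. R (pi1 z) (pi2 z) v)"
    by (rule semidecidable_selection[where R = "\<lambda>z. R (pi1 z) (pi2 z)"]) blast+
  \<comment> \<open>Only codes of strings are considered, since there base and cell are known to be
    almost everywhere decidable.\<close>
  have R: "R (string_code \<sigma>) k v \<longleftrightarrow>
      (\<exists>y. capital \<sigma> = Some y \<and> qrat v - (1 / 2) ^ k < y \<and> y < qrat v + (1 / 2) ^ k)" for \<sigma> k v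
  proof (cases "0 < prob (inside (cell_code (state \<sigma>)))")
    case True
    then have "0 < prob (inside (base_code (state \<sigma>)))" using prob_cell_le[of \<sigma>] by linarith
    with True show ?thesis
      unfolding R_def capital_def Let_def
      by (simp add: doubling_greater_iff doubling_less_iff prob_outside ae_decidable_state)
  next
    case False
    then show ?thesis by (simp add: R_def capital_def Let_def)
  qed
  have ex: "\<exists>v. R (string_code \<sigma>) k v" if y: "capital \<sigma> = Some y" for \<sigma> k y
  proof -
    obtain v where "y < qrat v" "qrat v < y + (1 / 2) ^ k"
      using qrat_dense[of y "y + (1 / 2) ^ k"] capital_nonneg[OF y] by auto
    then show ?thesis unfolding R using y by (intro exI[of _ v] exI[of _ y]) auto
  qed
  have "case capital \<sigma> of None \<Rightarrow> f (prod_encode (string_code \<sigma>, k)) = None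
      | Some y \<Rightarrow> \<exists>v. f (prod_encode (string_code \<sigma>, k)) = Some v \<and> \<bar>qrat v - y\<bar> \<le> (1 / 2) ^ k"
        for \<sigma> k
  proof (cases "capital \<sigma>")
    case None
    then show ?thesis by (simp add: f(3) R)
  next
    case (Some y)
    then obtain v where v: "f (prod_encode (string_code \<sigma>, k)) = Some v"
      using f(3)[of "prod_encode (string_code \<sigma>, k)"] ex by force
    from f(2)[OF v] Some have "\<bar>qrat v - y\<bar> \<le> (1 / 2) ^ k" by (auto simp: R)
    with Some v show ?thesis by simp
  qed
  with f(1) show ?thesis unfolding partial_computable_capital_def by blast
qed

lemma strategy_computable: "computable_betting_strategy a \<mu> strategy capital"
  unfolding computable_betting_strategy_def Let_def cell_eq ae_measure_def fst_conv
proof (intro conjI allI impI)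
  show "ae_decidable_code a \<mu> (strategy \<sigma>)" for \<sigma>
    using ae_decidable_query by (simp add: strategy_def ask_def ae_decidable_def)
  show "\<exists>h. recursive h \<and> (\<forall>\<sigma>. h (string_code \<sigma>) = prod_encode (strategy \<sigma>))"
    by (intro exI[of _ "\<lambda>y. ask (run y)"] conjI rec_intro recursive_run) (simp add: strategy_def)
  show "partial_computable_capital capital" by (rule capital_computable)
  show "0 \<le> y" if "capital \<sigma> = Some y" for \<sigma> y using that by (rule capital_nonneg)
  show "(capital \<sigma> \<noteq> None) = (0 < prob (inside (cell_code (state \<sigma>))))" for \<sigma>
    by (simp add: capital_def Let_def)
  fix \<sigma>
  \<comment> \<open>By \<open>stake_capital\<close>, fairness reduces to the splitting of the cell
    by the query.\<close>
  have "prob (inside (cell_code (state \<sigma>)) \<inter> inside (ask (state \<sigma>))) +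
      prob (inside (cell_code (state \<sigma>)) \<inter> outside (ask (state \<sigma>))) = prob (inside (cell_code (state \<sigma>)))"
    by (rule prob_split) (simp_all add: ask_def ae_decidable_query)
  note * = this
  show "stake (capital (\<sigma> @ [False])) (prob (inside (cell_code (state (\<sigma> @ [False]))))) +
      stake (capital (\<sigma> @ [True])) (prob (inside (cell_code (state (\<sigma> @ [True]))))) =
      stake (capital \<sigma>) (prob (inside (cell_code (state \<sigma>))))"
    unfolding stake_capital by (simp add: state_snoc *[symmetric] algebra_simps)
qed

text \<open>The path follows the true answers of \<open>x\<close>. If its cells stay of positive
  measure, a positive answer must come again and again, and each of them doubles the value attained
  right after the previous one.\<close>

lemma strategy_succeeds:
  assumes decided: "\<And>n m. x \<in> inside (q n m) \<union> outside (q n m)"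
    and hit: "\<And>n k. \<exists>m\<ge>k. x \<in> inside (q n m)"
  shows "succeeds_on a strategy capital x"
proof -
  define path where "path = rec_nat [] (\<lambda>_ \<sigma>. \<sigma> @ [x \<in> inside (ask (state \<sigma>))])"
  have path_Suc: "path (Suc t) = path t @ [x \<in> inside (ask (state (path t)))]" for t
    by (simp add: path_def)
  define S where "S t = state (path t)" for t
  have S_Suc: "S (Suc t) = (if x \<in> inside (ask (S t)) then win (S t) else lose (S t))" for t
    by (simp add: S_def path_Suc state_snoc)
  have decided': "x \<in> inside (query b m) \<union> outside (query b m)" for b m
    using decided by (simp add: query_def univ)
  have cell: "x \<in> inside (cell_code (S t))" for t
  proof (induction t)
    case 0 show ?case by (simp add: S_def path_def state_Nil)
  next
    case (Suc t) with decided' show ?case by (auto simp: S_Suc ask_def)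
  qed
  have cell_antimono: "inside (cell_code (S t')) \<subseteq> inside (cell_code (S t))" if "t \<le> t'" for t t'
    using that by (induction rule: dec_induct) (auto simp: S_Suc)
  have wins_mono: "wins (S t) \<le> wins (S t')" if "t \<le> t'" for t t'
    using that by (induction rule: dec_induct) (auto simp: S_Suc)
  have limsup: "limsup (\<lambda>t. capital_value (capital (path t))) = \<infinity>"
  proof (cases "\<exists>t. prob (inside (cell_code (S t))) = 0")
    \<comment> \<open>Nullity passes on to all later cells of the path, so the capital is eventually
      undefined, which counts as infinite.\<close>
    case True
    then obtain t where "prob (inside (cell_code (S t))) = 0" ..
    then have "capital (path t') = None" if "t \<le> t'" for t'
      using finite_measure_mono[OF cell_antimono[OF that]]
      by (simp add: capital_def Let_def S_def[symmetric] not_less)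
    then have "\<forall>\<^sub>F t' in sequentially. capital_value (capital (path t')) = \<infinity>"
      by (intro eventually_sequentiallyI[of t]) (simp add: capital_value_def)
    then have "limsup (\<lambda>t. capital_value (capital (path t))) = limsup (\<lambda>t. \<infinity>)"
      by (rule Limsup_eq)
    then show ?thesis by (simp add: Limsup_const)
  next
    case False
    then have pos: "0 < prob (inside (cell_code (S t)))" for t
      by (simp add: zero_less_measure_iff)
    have next_win: "\<exists>t'\<ge>t. x \<in> inside (ask (S t'))" for t
    proof (rule ccontr)
      assume "\<not> (\<exists>t'\<ge>t. x \<in> inside (ask (S t')))"
      then have no: "x \<notin> inside (ask (S (t + i)))" for i by simp
      define b where "b = pi1 (base_code (S t))"
      have base: "base_code (S (t + i)) = base_code (S t) \<and> time (S (t + i)) = time (S t) + i" for i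
        by (induction i) (use no in \<open>auto simp: S_Suc\<close>)
      have "0 < prob (sigma01 a b)"
        using pos[of t] prob_cell_le[of "path t"] unfolding b_def S_def by linarith
      then obtain m n where n: "level b m = Suc n"
        using level(4) by (metis not0_implies_Suc)
      \<comment> \<open>Beyond \<open>m\<close> the level is known, and beyond the current time the
        entry is still to come; so \<open>q n m'\<close> is really asked.\<close>
      obtain m' where m': "m' \<ge> max m (time (S t))" "x \<in> inside (q n m')" using hit by blast
      have "level b m' = Suc n" using level(2)[of b m m'] n m' by simp
      moreover have "x \<notin> inside (query b m')"
        using no[of "m' - time (S t)"] base[of "m' - time (S t)"] m'(1) by (simp add: ask_def b_def)
      ultimately show False using m'(2) by (simp add: query_def)
    qed
    have wins: "\<exists>t'\<ge>t. n \<le> wins (S t')" for n t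
    proof (induction n)
      case (Suc n)
      then obtain t1 where t1: "t \<le> t1" "n \<le> wins (S t1)" by blast
      obtain t2 where t2: "t1 \<le> t2" "x \<in> inside (ask (S t2))" using next_win by blast
      then have "Suc n \<le> wins (S (Suc t2))" using wins_mono[OF t2(1)] t1 by (simp add: S_Suc)
      with t1 t2 show ?case by (intro exI[of _ "Suc t2"]) simp
    qed blast
    have large: "\<exists>t'\<ge>t. ereal (2 ^ n) \<le> capital_value (capital (path t'))" for n t
    proof -
      obtain t1 where t1: "t \<le> t1" "n \<le> wins (S t1)" using wins by blast
      obtain t2 where t2: "t1 \<le> t2" "x \<in> inside (ask (S t2))" using next_win by blast
      \<comment> \<open>Right after a win the quotient of base and cell is 1, and the capital is
        exactly the power of 2.\<close>
      have "base_code (S (Suc t2)) = cell_code (S (Suc t2))" using t2 by (simp add: S_Suc)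
      then have "capital (path (Suc t2)) = Some (2 ^ wins (S (Suc t2)))"
        using pos[of "Suc t2"] by (simp add: capital_def Let_def S_def)
      moreover have "n \<le> wins (S (Suc t2))" using wins_mono[of t1 "Suc t2"] t1 t2 by simp
      then have "(2::real) ^ n \<le> 2 ^ wins (S (Suc t2))" by (intro power_increasing) simp_all
      ultimately show ?thesis
        using t1 t2 by (intro exI[of _ "Suc t2"]) (simp add: capital_value_def)
    qed
    have "ereal r \<le> limsup (\<lambda>t. capital_value (capital (path t)))" for r
    proof -
      obtain n where "r < 2 ^ n" using real_arch_pow[of 2 r] by auto
      have "ereal r \<le> (SUP t'\<in>{t..}. capital_value (capital (path t')))" for t
      proof -
        obtain t' where "t \<le> t'" "ereal (2 ^ n) \<le> capital_value (capital (path t'))"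
          using large by blast
        then have "ereal r \<le> capital_value (capital (path t'))"
          using \<open>r < 2 ^ n\<close> by (meson ereal_less_eq(3) less_imp_le order_trans)
        with \<open>t \<le> t'\<close> show ?thesis by (intro SUP_upper2[of t']) auto
      qed
      then show ?thesis unfolding limsup_INF_SUP by (intro INF_greatest)
    qed
    then show ?thesis by (metis ereal_top)
  qed
  show ?thesis
    unfolding succeeds_on_def
    by (intro exI[of _ path] conjI allI limsup)
       (use cell in \<open>auto simp: path_Suc ae_mem_def cell_eq S_def strict_prefix_def\<close>)
qed

end

section \<open>From betting randomness to Martin-Loef randomness\<close>

context coded_sets
begin

text \<open>Packages the machine: \<open>recursive_level\<close> supplies the lower bounds, so a
  refutation of betting randomness only has to exhibit suitable queries.\<close>

lemma not_betting_random_queries: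
  assumes "recursive (\<lambda>z. q (pi1 z) (pi2 z))"
    "\<And>n m. ae_decidable (q n m)"
    "\<And>n. prob (\<Union>m. inside (q n m)) \<le> (1 / 2) ^ n"
    "\<And>n m. x \<in> inside (q n m) \<union> outside (q n m)"
    "\<And>n k. \<exists>m\<ge>k. x \<in> inside (q n m)"
  shows "\<not> betting_random a \<mu> x"
proof -
  obtain level where level: "recursive (\<lambda>z. level (pi1 z) (pi2 z))"
    "\<And>e m m'. level e m \<noteq> 0 \<Longrightarrow> m \<le> m' \<Longrightarrow> level e m' = level e m"
    "\<And>e m n. level e m = Suc n \<Longrightarrow> 2 * (1 / 2) ^ n \<le> prob (sigma01 a e)"
    "\<And>e. 0 < prob (sigma01 a e) \<Longrightarrow> \<exists>m. level e m \<noteq> (0::nat)"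
    by (rule recursive_level) blast
  interpret betting_machine a \<mu> inter union empty univ level q
    using assms(1,2,3) level unfolding ae_decidable_def by unfold_locales
  show ?thesis
    using strategy_computable strategy_succeeds[OF assms(4,5)] unfolding betting_random_def by blast
qed

text \<open>The null set outside the two sets is covered by finite intersections of complements of closed
  balls. The balls being slightly smaller than the ones that exhaust the two sets, each of these
  intersections decides \<open>x\<close>.\<close>

lemma betting_random_decided:
  assumes c: "ae_decidable_code a \<mu> c" and x: "x \<notin> sigma01 a (fst c) \<union> sigma01 a (snd c)"
  shows "\<not> betting_random a \<mu> x"
proof -
  define e where "e = union (fst c) (snd c)"
  have e: "sigma01 a e = sigma01 a (fst c) \<union> sigma01 a (snd c)" by (simp add: e_def union(2))
  obtain b where b: "recursive b"
    "\<And>z. ae_decidable_code a \<mu> (prod_decode (b z))"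
    "\<And>i l u. inside (b (prod_encode (i, prod_encode (l, u)))) \<subseteq> ball (a i) (qrat u)"
    "\<And>i l u. qrat l < qrat u \<Longrightarrow>
       cball (a i) (qrat l) \<subseteq> inside (b (prod_encode (i, prod_encode (l, u))))"
    "\<And>i l u. - ball (a i) (qrat u) \<subseteq> outside (b (prod_encode (i, prod_encode (l, u))))"
    by (rule ae_decidable_balls) blast
  have "semidecidable (\<lambda>w. w \<in> W e)" by (intro sem_intro rec_intro)
  then obtain D where D: "decidable (\<lambda>z. D (pi1 z) (pi2 z))" "\<And>w. w \<in> W e \<longleftrightarrow> (\<exists>t. D w t)"
    by (rule semidecidableE) blast
  \<comment> \<open>\<open>m\<close> codes a center \<open>i\<close>, radii \<open>l\<close> and
    \<open>u\<close>, and a witness that the ball \<open>(i, u)\<close> is listed in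
    \<open>W e\<close>. The complement of the perturbed ball is taken if the witness is correct, the
    whole space otherwise.\<close>
  define q where "q m = (if D (prod_encode (pi1 (pi1 m), pi2 (pi2 (pi1 m)))) (pi2 m)
    then compl_code (b (pi1 m)) else prod_encode (univ, empty))" for m
  have rec_q: "recursive (\<lambda>z. q (f z))" if "recursive f" for f
    unfolding q_def compl_code_def
    by (intro rec_intro decidable_comp2[OF D(1)] recursive_comp[OF b(1)] that)
  have ae_decidable_q: "ae_decidable (q m)" for m
    using b(2)[of "pi1 m"] unfolding q_def
    by (auto simp: ae_decidable_compl ae_decidable_def[symmetric]) (simp add: ae_decidable_iff univ empty)
  have x_q: "x \<in> inside (q m)" for m
  proof (cases "D (prod_encode (pi1 (pi1 m), pi2 (pi2 (pi1 m)))) (pi2 m)")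
    case True
    obtain i l u where m: "pi1 m = prod_encode (i, prod_encode (l, u))"
      by (metis prod.collapse prod_decode_inverse)
    from True have "prod_encode (i, u) \<in> W e" unfolding D(2) m by auto
    then have "ball (a i) (qrat u) \<subseteq> sigma01 a e" unfolding sigma01_eq by force
    with x e have "x \<in> - ball (a i) (qrat u)" by blast
    with b(5)[of i u l] True show ?thesis by (auto simp: q_def m)
  qed (simp add: q_def univ)
  define C where "C s = rec_nat (prod_encode (univ, empty)) (\<lambda>m P. meet P (q m)) s" for s
  have C_simps [simp]: "C 0 = prod_encode (univ, empty)" "C (Suc s) = meet (C s) (q s)" for s
    by (simp_all add: C_def)
  have rec_C: "recursive (\<lambda>z. C (f z))" if "recursive f" for f
    unfolding C_def by (intro rec_intro rec_q that)
  have ae_decidable_C: "ae_decidable (C s)" for s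
    by (induction s) (simp_all add: ae_decidable_meet ae_decidable_q, simp add: ae_decidable_iff univ empty)
  have x_C: "x \<in> inside (C s)" for s
    by (induction s) (simp_all add: x_q univ)
  have outside_C: "outside (C s) = (\<Union>m<s. outside (q m))" for s
    by (induction s) (auto simp: empty lessThan_Suc)
  have "sigma01 a e \<subseteq> (\<Union>m. outside (q m))"
  proof
    fix y assume "y \<in> sigma01 a e"
    then obtain w where w: "w \<in> W e" "dist (a (pi1 w)) y < qrat (pi2 w)" by (auto simp: sigma01_eq)
    \<comment> \<open>With \<open>l\<close> strictly between distance and radius, \<open>y\<close>
      lies in the perturbed ball whatever its actual radius is.\<close>
    obtain l where l: "dist (a (pi1 w)) y < qrat l" "qrat l < qrat (pi2 w)"
      using qrat_dense[OF _ w(2)] by auto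
    obtain t where t: "D w t" using w(1) D(2) by blast
    define m where "m = prod_encode (prod_encode (pi1 w, prod_encode (l, pi2 w)), t)"
    have "y \<in> outside (q m)"
      using t l(1) b(4)[OF l(2), of "pi1 w"] by (auto simp: q_def m_def)
    then show "y \<in> (\<Union>m. outside (q m))" by blast
  qed
  moreover have "(\<Union>m. outside (q m)) = (\<Union>s. outside (C s))"
    using UN_UN_finite_eq[of "\<lambda>m. outside (q m)"] by (simp only: outside_C atLeast0LessThan)
  ultimately have "prob (sigma01 a e) \<le> prob (\<Union>s. outside (C s))"
    by (intro finite_measure_mono) auto
  then have one: "prob (\<Union>s. outside (C s)) = 1"
    using c by (intro antisym) (simp_all add: ae_decidable_code_iff e)
  have "(\<lambda>s. prob (outside (C s))) \<longlonglongrightarrow> prob (\<Union>s. outside (C s))"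
    by (rule finite_Lim_measure_incseq) (auto simp: outside_C incseq_def intro: less_le_trans)
  then have lim: "(\<lambda>s. prob (outside (C s))) \<longlonglongrightarrow> 1" unfolding one .
  have close: "\<exists>s. 1 - (1 / 2) ^ n < prob (outside (C s))" for n
    using eventually_happens'[OF sequentially_bot order_tendstoD(1)[OF lim]] by simp
  have "semidecidable (\<lambda>z. 1 - (1 / 2) ^ pi1 z < prob (outside (C (pi2 z))))"
    by (intro sem_intro eo_intro rec_intro rec_C)
  from recursive_selection[where R = "\<lambda>n s. 1 - (1 / 2) ^ n < prob (outside (C s))", OF this close]
  obtain r where r: "recursive r" "\<And>n. 1 - (1 / 2) ^ n < prob (outside (C (r n)))" by blast
  show ?thesis
  \<comment> \<open>At each level one and the same set, containing \<open>x\<close> and of measure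
    below \<open>(1 / 2) ^ n\<close>, is asked at all times, so hits recur trivially.\<close>
  proof (rule not_betting_random_queries)
    show "recursive (\<lambda>z. C (r (pi1 z)))" by (intro rec_C recursive_comp[OF r(1)] rec_intro)
    show "ae_decidable (C (r n))" for n by (rule ae_decidable_C)
    show "prob (\<Union>m. inside (C (r n))) \<le> (1 / 2) ^ n" for n
      using r(2)[of n] prob_outside[OF ae_decidable_C, of "r n"] by simp
    show "x \<in> inside (C (r n)) \<union> outside (C (r n))" for n using x_C by blast
    show "\<exists>m\<ge>k. x \<in> inside (C (r n))" for n and k :: nat using x_C by auto
  qed
qed

lemma betting_random_imp_martin_lof_random:
  assumes "betting_random a \<mu> x" shows "martin_lof_random a \<mu> x"
proof (rule ccontr)
  assume "\<not> martin_lof_random a \<mu> x"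
  then obtain U where test: "martin_lof_test a \<mu> U" and xU: "x \<in> (\<Inter>n. U n)"
    by (auto simp: martin_lof_random_def)
  then obtain f where f: "recursive f" "\<And>n. U n = sigma01 a (f n)"
    and small: "\<And>n. prob (U n) \<le> (1 / 2) ^ n"
    by (auto simp: martin_lof_test_def)
  obtain b where b: "recursive b"
    "\<And>z. ae_decidable_code a \<mu> (prod_decode (b z))"
    "\<And>i l u. inside (b (prod_encode (i, prod_encode (l, u)))) \<subseteq> ball (a i) (qrat u)"
    "\<And>i l u. qrat l < qrat u \<Longrightarrow>
       cball (a i) (qrat l) \<subseteq> inside (b (prod_encode (i, prod_encode (l, u))))"
    "\<And>i l u. - ball (a i) (qrat u) \<subseteq> outside (b (prod_encode (i, prod_encode (l, u))))"
    by (rule ae_decidable_balls) blast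
  \<comment> \<open>By betting randomness, \<open>x\<close> avoids the null set left undecided by
    each single perturbed ball.\<close>
  have decided: "x \<in> inside (b z) \<union> outside (b z)" for z
    using betting_random_decided[OF b(2)] assms by blast
  have "semidecidable (\<lambda>z. pi2 z \<in> W (f (pi1 z)))"
    by (intro sem_intro rec_intro recursive_comp[OF f(1)])
  then obtain D where D: "decidable (\<lambda>z. D (pi1 z) (pi2 z))"
      "\<And>z. pi2 z \<in> W (f (pi1 z)) \<longleftrightarrow> (\<exists>t. D z t)"
    by (rule semidecidableE) blast
  have D_iff: "w \<in> W (f n) \<longleftrightarrow> (\<exists>t. D (prod_encode (n, w)) t)" for n w
    using D(2)[of "prod_encode (n, w)"] by simp
  \<comment> \<open>\<open>m\<close> codes a perturbed ball, a witness that the ball is listed in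
    \<open>W (f n)\<close>, and a dummy component. The dummy makes every query recur at arbitrarily
    late positions.\<close>
  define q where "q n m = (if D (prod_encode (n, prod_encode (pi1 (pi1 m), pi2 (pi2 (pi1 m))))) (pi1 (pi2 m))
    then b (pi1 m) else prod_encode (empty, univ))" for n m
  have "\<not> betting_random a \<mu> x"
  proof (rule not_betting_random_queries)
    show "recursive (\<lambda>z. q (pi1 z) (pi2 z))"
      unfolding q_def by (intro rec_intro decidable_comp2[OF D(1)] recursive_comp[OF b(1)])
    show "ae_decidable (q n m)" for n m
      using b(2) unfolding q_def
        by (auto simp: ae_decidable_def[symmetric]) (simp add: ae_decidable_iff univ empty)
    show "x \<in> inside (q n m) \<union> outside (q n m)" for n m
      using decided by (simp add: q_def univ)
    show "prob (\<Union>m. inside (q n m)) \<le> (1 / 2) ^ n" for n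
    proof -
      have "inside (q n m) \<subseteq> U n" for m
      proof (cases "D (prod_encode (n, prod_encode (pi1 (pi1 m), pi2 (pi2 (pi1 m))))) (pi1 (pi2 m))")
        case True
        obtain i l u where m: "pi1 m = prod_encode (i, prod_encode (l, u))"
          by (metis prod.collapse prod_decode_inverse)
        from True have "prod_encode (i, u) \<in> W (f n)" unfolding D_iff m by auto
        then have "ball (a i) (qrat u) \<subseteq> U n" unfolding f(2) sigma01_eq by force
        with b(3)[of i l u] True show ?thesis by (auto simp: q_def m)
      qed (simp add: q_def empty)
      then have "prob (\<Union>m. inside (q n m)) \<le> prob (U n)"
        by (intro finite_measure_mono) (auto simp: f(2))
      with small[of n] show ?thesis by linarith
    qed
    fix n k
    have "x \<in> sigma01 a (f n)" using xU f(2) by auto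
    then obtain w where w: "w \<in> W (f n)" "dist (a (pi1 w)) x < qrat (pi2 w)"
      by (auto simp: sigma01_eq)
    obtain l where l: "dist (a (pi1 w)) x < qrat l" "qrat l < qrat (pi2 w)"
      using qrat_dense[OF _ w(2)] by auto
    obtain t where t: "D (prod_encode (n, w)) t" using w(1) D_iff by blast
    define m where "m = prod_encode (prod_encode (pi1 w, prod_encode (l, pi2 w)), prod_encode (t, k))"
    have "k \<le> m" unfolding m_def by (meson le_prod_encode_2 le_trans)
    moreover have "x \<in> inside (q n m)"
      using t l(1) b(4)[OF l(2), of "pi1 w"] by (auto simp: q_def m_def)
    ultimately show "\<exists>m\<ge>k. x \<in> inside (q n m)" by blast
  qed
  with assms show False by blast
qed

section \<open>Ville's inequality\<close>

context
  fixes c :: "bool list \<Rightarrow> nat \<times> nat" and M :: "bool list \<Rightarrow> real option"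
  assumes strategy: "computable_betting_strategy a \<mu> c M"
begin

abbreviation B :: "bool list \<Rightarrow> 'a set" where "B \<sigma> \<equiv> fst (cell (\<lambda>\<tau>. ae_set a (c \<tau>)) \<sigma>)"

lemma strategy_simps:
  "M \<sigma> = Some y \<Longrightarrow> 0 \<le> y" "M \<sigma> \<noteq> None \<longleftrightarrow> 0 < prob (B \<sigma>)"
  "stake (M (\<sigma> @ [False])) (prob (B (\<sigma> @ [False]))) + stake (M (\<sigma> @ [True])) (prob (B (\<sigma> @ [True])))
     = stake (M \<sigma>) (prob (B \<sigma>))"
  using strategy by (auto simp: computable_betting_strategy_def ae_measure_def Let_def)

lemma B_Nil: "B [] = UNIV" by (simp add: cell_Nil)

lemma B_snoc:
  "B (\<sigma> @ [b]) = B \<sigma> \<inter> (if b then sigma01 a (fst (c \<sigma>)) else sigma01 a (snd (c \<sigma>)))"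
  by (cases b) (simp_all add: cell_snoc_True cell_snoc_False ae_inter_def ae_compl_def ae_set_def)

lemma open_B: "open (B \<sigma>)"
  by (induction \<sigma> rule: rev_induct) (simp_all add: B_Nil B_snoc open_Int)

lemma B_measurable [measurable]: "B \<sigma> \<in> events"
  by (rule open_sets) (rule open_B)

lemma B_append: "B (\<sigma> @ \<tau>) \<subseteq> B \<sigma>"
proof (induction \<tau> rule: rev_induct)
  case (snoc b \<tau>)
  then show ?case using B_snoc[of "\<sigma> @ \<tau>" b] by auto
qed simp

lemma stake_nonneg: "0 \<le> stake (M \<sigma>) (prob (B \<sigma>))"
  using strategy_simps(1)[of \<sigma>] by (auto simp: stake_def split: option.split)

definition exceeding :: "real \<Rightarrow> bool list \<Rightarrow> bool" where
  "exceeding r \<sigma> \<longleftrightarrow> (\<exists>y. M \<sigma> = Some y \<and> r < y)"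

definition reached :: "real \<Rightarrow> nat \<Rightarrow> bool list \<Rightarrow> 'a set" where
  "reached r d \<sigma> = (\<Union>\<tau>\<in>{\<tau>. length \<tau> \<le> d \<and> exceeding r (\<sigma> @ \<tau>)}. B (\<sigma> @ \<tau>))"

lemma reached_measurable [measurable]: "reached r d \<sigma> \<in> events"
  unfolding reached_def by (rule open_sets) (auto intro: open_B)

text \<open>If \<open>\<sigma>\<close> itself exceeds \<open>r\<close>, the reached set lies in its
  cell, where the capital is larger than \<open>r\<close>. Otherwise it is covered by the reached
  sets of the two successors, and fairness adds up their bounds.\<close>

lemma ville_finite:
  assumes "0 \<le> r" shows "r * prob (reached r d \<sigma>) \<le> stake (M \<sigma>) (prob (B \<sigma>))"
proof (induction d arbitrary: \<sigma>)
  have exceed: "r * prob (reached r d \<sigma>) \<le> stake (M \<sigma>) (prob (B \<sigma>))" if ex: "exceeding r \<sigma>" for d \<sigma>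
  proof -
    obtain y where y: "M \<sigma> = Some y" "r < y" using ex by (auto simp: exceeding_def)
    have "prob (reached r d \<sigma>) \<le> prob (B \<sigma>)"
      unfolding reached_def using B_append by (intro finite_measure_mono) auto
    then have "r * prob (reached r d \<sigma>) \<le> y * prob (B \<sigma>)"
      using y assms by (intro mult_mono) auto
    with y show ?thesis by (simp add: stake_def)
  qed
  {
    case 0
    show ?case
    proof (cases "exceeding r \<sigma>")
      case False
      then have "reached r 0 \<sigma> = {}" by (simp add: reached_def)
      then show ?thesis using stake_nonneg by simp
    qed (rule exceed)
  next
    case (Suc d)
    show ?case
    proof (cases "exceeding r \<sigma>")
      case False
      have "reached r (Suc d) \<sigma> \<subseteq> reached r d (\<sigma> @ [False]) \<union> reached r d (\<sigma> @ [True])"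
      proof
        fix y assume "y \<in> reached r (Suc d) \<sigma>"
        then obtain \<tau> where \<tau>: "length \<tau> \<le> Suc d" "exceeding r (\<sigma> @ \<tau>)" "y \<in> B (\<sigma> @ \<tau>)"
          by (auto simp: reached_def)
        with False obtain b \<tau>' where "\<tau> = b # \<tau>'" by (cases \<tau>) auto
        with \<tau> have "y \<in> reached r d (\<sigma> @ [b])" unfolding reached_def by auto
        then show "y \<in> reached r d (\<sigma> @ [False]) \<union> reached r d (\<sigma> @ [True])"
          by (cases b) auto
      qed
      then have "prob (reached r (Suc d) \<sigma>) \<le> prob (reached r d (\<sigma> @ [False]) \<union> reached r d (\<sigma> @ [True]))"
        by (rule finite_measure_mono) measurable
      also have "\<dots> \<le> prob (reached r d (\<sigma> @ [False])) + prob (reached r d (\<sigma> @ [True]))"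
        by (intro measure_Un_le) measurable
      finally have "r * prob (reached r (Suc d) \<sigma>) \<le>
          r * prob (reached r d (\<sigma> @ [False])) + r * prob (reached r d (\<sigma> @ [True]))"
        using assms by (metis distrib_left mult_left_mono)
      then show ?thesis
        using Suc[of "\<sigma> @ [False]"] Suc[of "\<sigma> @ [True]"] strategy_simps(3)[of \<sigma>] by linarith
    qed (rule exceed)
  }
qed

text \<open>The limit of \<open>ville_finite\<close> over growing depth at the root, whose cell has
  measure 1.\<close>

lemma ville:
  assumes "0 \<le> r" shows "r * prob (\<Union>\<sigma>\<in>{\<sigma>. exceeding r \<sigma>}. B \<sigma>) \<le> stake (M []) 1"
proof -
  have "(\<Union>\<sigma>\<in>{\<sigma>. exceeding r \<sigma>}. B \<sigma>) = (\<Union>d. reached r d [])"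
    unfolding reached_def by auto
  moreover have "(\<lambda>d. prob (reached r d [])) \<longlonglongrightarrow> prob (\<Union>d. reached r d [])"
    by (rule finite_Lim_measure_incseq) (auto simp: incseq_def reached_def, meson le_trans)
  then have "(\<lambda>d. r * prob (reached r d [])) \<longlonglongrightarrow> r * prob (\<Union>d. reached r d [])"
    by (rule tendsto_mult_left)
  moreover have "r * prob (reached r d []) \<le> stake (M []) 1" for d
    using ville_finite[OF assms, of d "[]"] prob_space by (simp add: B_Nil)
  ultimately show ?thesis by (metis LIMSEQ_le_const2)
qed

text \<open>The state of the fold is the code of the reversed prefix together with the index of its cell.
  Any number codes a string, all positive entries being read as \<open>True\<close>.\<close>

lemma effectively_open_B:
  obtains g where "effectively_open (\<lambda>y. B (map (\<lambda>n. n \<noteq> 0) (list_decode y)))"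
    "recursive g" "\<And>y. g y = string_code (map (\<lambda>n. n \<noteq> 0) (list_decode y))"
proof -
  obtain h where h: "recursive h" "\<And>\<sigma>. h (string_code \<sigma>) = prod_encode (c \<sigma>)"
    using strategy by (auto simp: computable_betting_strategy_def Let_def)
  define rev_code where
    "rev_code y = foldl (\<lambda>s b. Suc (prod_encode (b, s))) 0 (list_decode y)" for y
  have rec_rev: "recursive (\<lambda>x. rev_code (f x))" if "recursive f" for f
    unfolding rev_code_def by (intro recursive_foldl rec_intro that)
  have foldl_rev: "foldl (\<lambda>s b. Suc (prod_encode (b, s))) (list_encode ys) xs = list_encode (rev xs @ ys)"
    for xs ys
    by (induction xs arbitrary: ys) (simp_all flip: list_encode.simps)
  have rev_code: "rev_code (list_encode xs) = list_encode (rev xs)" for xs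
    using foldl_rev[of "[]" xs] by (simp add: rev_code_def)
  \<comment> \<open>A bit can only be put in front of a coded list; \<open>rev_code\<close> restores
    the order before \<open>h\<close> is applied. Bits are normalised to 0 and 1, so that a true
    \<open>string_code\<close> results.\<close>
  define step where "step s b = prod_encode
    (Suc (prod_encode (if b = 0 then 0 else 1, pi1 s)),
     inter (pi2 s) (if b = 0 then pi2 (h (rev_code (pi1 s))) else pi1 (h (rev_code (pi1 s)))))"
       for s and b :: nat
  define run where "run y = foldl step (prod_encode (0, univ)) (list_decode y)" for y
  have rec_run: "recursive run"
    unfolding run_def step_def
    by (intro recursive_foldl rec_intro recursive_comp2[OF inter(1)] recursive_comp[OF h(1)] rec_rev)
  have fold: "pi1 (foldl step (prod_encode (0, univ)) xs) = list_encode (rev (map of_bool (map (\<lambda>n. n \<noteq> 0) xs))) \<and>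
      sigma01 a (pi2 (foldl step (prod_encode (0, univ)) xs)) = B (map (\<lambda>n. n \<noteq> 0) xs)" for xs
  proof (induction xs rule: rev_induct)
    case Nil show ?case by (simp add: univ cell_Nil)
  next
    case (snoc n xs)
    let ?s = "foldl step (prod_encode (0, univ)) xs" and ?\<sigma> = "map (\<lambda>n. n \<noteq> 0) xs"
    have "rev_code (pi1 ?s) = string_code ?\<sigma>"
      using snoc by (simp add: rev_code string_code_def)
    then have "h (rev_code (pi1 ?s)) = prod_encode (c ?\<sigma>)" by (simp add: h(2))
    then show ?case
      using snoc by (simp add: step_def inter(2) B_snoc)
  qed
  show ?thesis
  proof (rule that)
    have "B (map (\<lambda>n. n \<noteq> 0) (list_decode y)) = sigma01 a (pi2 (run y))" for y
      using fold by (simp add: run_def)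
    then show "effectively_open (\<lambda>y. B (map (\<lambda>n. n \<noteq> 0) (list_decode y)))"
      by simp (intro eo_intro rec_intro rec_run)
    show "recursive (\<lambda>y. rev_code (pi1 (run y)))" by (intro rec_rev rec_intro rec_run)
    show "rev_code (pi1 (run y)) = string_code (map (\<lambda>n. n \<noteq> 0) (list_decode y))" for y
      using fold[of "list_decode y"] by (simp add: run_def rev_code string_code_def)
  qed
qed

lemma decode_string_code: "map (\<lambda>n. n \<noteq> 0) (list_decode (string_code \<sigma>)) = \<sigma>"
  by (simp add: string_code_def comp_def)

lemma exceeding_test:
  obtains U where "martin_lof_test a \<mu> U"
    "\<And>x. (\<And>r. \<exists>\<sigma>. exceeding r \<sigma> \<and> x \<in> B \<sigma>) \<Longrightarrow> x \<in> (\<Inter>n. U n)"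
proof -
  let ?dec = "\<lambda>y. map (\<lambda>n. n \<noteq> (0::nat)) (list_decode y)"
  obtain g where eo: "effectively_open (\<lambda>y. B (?dec y))"
    and g: "recursive g" "\<And>y. g y = string_code (?dec y)"
    by (rule effectively_open_B) (rule that)
  obtain f where f: "partial_recursive f"
    and fM: "\<And>\<sigma> k. case M \<sigma> of None \<Rightarrow> f (prod_encode (string_code \<sigma>, k)) = None
      | Some y \<Rightarrow> \<exists>v. f (prod_encode (string_code \<sigma>, k)) = Some v \<and> \<bar>qrat v - y\<bar> \<le> (1 / 2) ^ k"
    using strategy unfolding computable_betting_strategy_def Let_def partial_computable_capital_def by blast
  \<comment> \<open>With the threshold \<open>K * 2 ^ n\<close>, Ville's inequality yields the bound
    \<open>(1 / 2) ^ n\<close>. A natural number \<open>K\<close> keeps the threshold rational even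
    if the initial capital is not.\<close>
  obtain K where K: "stake (M []) 1 \<le> real K" "0 < K"
    using real_arch_simple[of "max 1 (stake (M []) 1)"]
      by (metis max.bounded_iff of_nat_0_less_iff zero_less_one less_le_trans)
  \<comment> \<open>Exceeding \<open>r\<close> is visible from an approximation of the capital with
    known error, hence enumerable; an undefined capital never produces a witness.\<close>
  have ex_iff: "exceeding r \<sigma> \<longleftrightarrow>
      (\<exists>k v. f (prod_encode (string_code \<sigma>, k)) = Some v \<and> r + (1 / 2) ^ k < qrat v)" for r \<sigma>
  proof
    assume "exceeding r \<sigma>"
    then obtain y where y: "M \<sigma> = Some y" "0 < (y - r) / 2" by (auto simp: exceeding_def)
    obtain k where k: "(1 / 2) ^ k < (y - r) / 2" using half_power_less[OF y(2)] by blast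
    obtain v where v: "f (prod_encode (string_code \<sigma>, k)) = Some v" "\<bar>qrat v - y\<bar> \<le> (1 / 2) ^ k"
      using fM[of \<sigma> k] y(1) by auto
    have "\<bar>t - y\<bar> \<le> e \<Longrightarrow> e < (y - r) / 2 \<Longrightarrow> r + e < t" for t e by argo
    from this[OF v(2) k] v(1)
    show "\<exists>k v. f (prod_encode (string_code \<sigma>, k)) = Some v \<and> r + (1 / 2) ^ k < qrat v" by blast
  next
    assume "\<exists>k v. f (prod_encode (string_code \<sigma>, k)) = Some v \<and> r + (1 / 2) ^ k < qrat v"
    then obtain k v where v: "f (prod_encode (string_code \<sigma>, k)) = Some v" "r + (1 / 2) ^ k < qrat v"
      by blast
    with fM[of \<sigma> k] obtain y where y: "M \<sigma> = Some y" "\<bar>qrat v - y\<bar> \<le> (1 / 2) ^ k"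
      by (auto split: option.splits)
    have "\<bar>t - y\<bar> \<le> e \<Longrightarrow> r + e < t \<Longrightarrow> r < y" for t e by argo
    from this[OF y(2) v(2)] y(1) show "exceeding r \<sigma>" by (simp add: exceeding_def)
  qed
  define U where "U n = (\<Union>y\<in>{y. exceeding (real K * 2 ^ n) (?dec y)}. B (?dec y))" for n
  have U: "U n = (\<Union>\<sigma>\<in>{\<sigma>. exceeding (real K * 2 ^ n) \<sigma>}. B \<sigma>)" for n
  proof -
    have "{\<sigma>. exceeding (real K * 2 ^ n) \<sigma>} = ?dec ` {y. exceeding (real K * 2 ^ n) (?dec y)}"
      using decode_string_code[symmetric] by (auto intro!: image_eqI)
    then show ?thesis unfolding U_def by simp
  qed
  show ?thesis
  proof (rule that)
    have "effectively_open U"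
      unfolding U_def ex_iff g(2)[symmetric]
      by (intro eo_intro sem_intro rec_intro effectively_open_comp[OF eo] recursive_comp[OF g(1)]
          semidecidable_comp2[OF semidecidable_graph[OF f]])
    moreover have "prob (U n) \<le> (1 / 2) ^ n" for n
    proof -
      have "real K * 2 ^ n * prob (U n) \<le> stake (M []) 1"
        unfolding U by (rule ville) simp
      also note K(1)
      finally have "2 ^ n * prob (U n) \<le> 1"
        using mult_le_cancel_left_pos[of "real K" "2 ^ n * prob (U n)" 1] K(2)
          by (simp add: mult.assoc)
      then show ?thesis by (simp add: power_one_over field_simps)
    qed
    ultimately show "martin_lof_test a \<mu> U"
      unfolding martin_lof_test_def effectively_open_def by blast
    show "x \<in> (\<Inter>n. U n)" if "\<And>r. \<exists>\<sigma>. exceeding r \<sigma> \<and> x \<in> B \<sigma>" for x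
      using that unfolding U by blast
  qed
qed

text \<open>Undefined capital counts as success, and this case is covered by a constant test: a null
  cell is effectively open and small enough for every level.\<close>

lemma null_cell_test:
  assumes "prob (B \<sigma>) = 0" shows "martin_lof_test a \<mu> (\<lambda>_. B \<sigma>)"
proof -
  obtain g where eo: "effectively_open (\<lambda>y. B (map (\<lambda>n. n \<noteq> 0) (list_decode y)))" "recursive g"
    by (rule effectively_open_B) (rule that)
  have "effectively_open (\<lambda>n. B (map (\<lambda>n. n \<noteq> 0) (list_decode (string_code \<sigma>))))"
    by (rule effectively_open_comp[OF eo(1)]) (rule recursive_const)
  with assms show ?thesis
    unfolding decode_string_code by (simp add: martin_lof_test_def effectively_open_def)
qed

text \<open>Success has two sources: a null cell on the chain, or finite capitals that are
  unbounded. Each has its own test.\<close>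

lemma succeeds_imp_not_random:
  assumes "succeeds_on a c M x" shows "\<not> martin_lof_random a \<mu> x"
proof -
  obtain \<sigma> where x: "\<And>n. x \<in> B (\<sigma> n)" and lim: "limsup (\<lambda>n. capital_value (M (\<sigma> n))) = \<infinity>"
    using assms by (auto simp: succeeds_on_def ae_mem_def)
  show ?thesis
  proof (cases "\<exists>n. M (\<sigma> n) = None")
    case True
    then obtain n where "M (\<sigma> n) = None" ..
    then have "prob (B (\<sigma> n)) = 0" using strategy_simps(2)[of "\<sigma> n"]
      by (simp add: zero_less_measure_iff)
    from null_cell_test[OF this] x[of n] show ?thesis unfolding martin_lof_random_def by blast
  next
    case False
    have "\<exists>\<tau>. exceeding r \<tau> \<and> x \<in> B \<tau>" for r
    proof (rule ccontr)
      assume none: "\<not> (\<exists>\<tau>. exceeding r \<tau> \<and> x \<in> B \<tau>)"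
      have "capital_value (M (\<sigma> n)) \<le> ereal r" for n
      proof -
        obtain y where "M (\<sigma> n) = Some y" using False by (metis not_Some_eq)
        moreover from this none x[of n] have "\<not> r < y" by (auto simp: exceeding_def)
        ultimately show ?thesis by (simp add: capital_value_def)
      qed
      then have "limsup (\<lambda>n. capital_value (M (\<sigma> n))) \<le> ereal r" by (intro Limsup_bounded) simp
      with lim show False by simp
    qed
    then show ?thesis using exceeding_test unfolding martin_lof_random_def by metis
  qed
qed

end

end

text \<open>The closure of effectively open families under intersection and union, applied to the
  universal family \<open>sigma01\<close>, yields operations on indices.\<close>

lemma (in computable_space) coded_sets_exist:
  obtains inter union empty univ where "coded_sets a \<mu> inter union empty univ"
proof -
  have "effectively_open (\<lambda>z. sigma01 a (pi1 z) \<inter> sigma01 a (pi2 z))" by (intro eo_intro rec_intro)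
  then obtain f where f: "recursive f" "\<And>z. sigma01 a (f z) = sigma01 a (pi1 z) \<inter> sigma01 a (pi2 z)"
    by (rule effectively_openE) blast
  have "effectively_open (\<lambda>z. sigma01 a (pi1 z) \<union> sigma01 a (pi2 z))" by (intro eo_intro rec_intro)
  then obtain g where g: "recursive g" "\<And>z. sigma01 a (g z) = sigma01 a (pi1 z) \<union> sigma01 a (pi2 z)"
    by (rule effectively_openE) blast
  obtain empty where "sigma01 a empty = {}" using effectively_openE[OF effectively_open_empty] by metis
  moreover obtain univ where "sigma01 a univ = UNIV" using effectively_openE[OF effectively_open_UNIV] by metis
  ultimately have "coded_sets a \<mu> (\<lambda>d e. f (prod_encode (d, e))) (\<lambda>d e. g (prod_encode (d, e))) empty univ"
    by unfold_locales (simp_all add: f g)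
  then show ?thesis by (rule that)
qed

theorem theorem9p2:
  fixes a :: "nat \<Rightarrow> 'a::polish_space" and \<mu> :: "'a measure" and x :: 'a
  assumes "computable_probability_space a \<mu>"
  shows "betting_random a \<mu> x \<longleftrightarrow> martin_lof_random a \<mu> x"
proof -
  interpret computable_space a \<mu> by unfold_locales (rule assms)
  obtain inter union empty univ where "coded_sets a \<mu> inter union empty univ"
    by (rule coded_sets_exist)
  then interpret coded_sets a \<mu> inter union empty univ .
  show ?thesis
  proof
    assume "martin_lof_random a \<mu> x"
    then show "betting_random a \<mu> x"
      using succeeds_imp_not_random unfolding betting_random_def by blast
  qed (rule betting_random_imp_martin_lof_random)
qed

end
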